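(* Let $k\ge 4$ be an even integer and let $p\ge 7$ be a prime number such that $p-1>2k-2$. Assume that $\mathrm{ord}_p(B_kB_{2k-2}h_p^+)=0$. Then there is no Hecke eigen Siegel cusp form of weight $k$ for $\mathrm{Sp}_4(\mathbb{Z})$ which is congruent to $G_k$ modulo a prime over $p$. In particular, if Vandiver's conjecture is true, then the same conclusion holds under the condition $\mathrm{ord}_p(B_kB_{2k-2})=0$, which depends only on $k$.
   Context: $\mathbb{H}_2=\{Z\in M_2(\mathbb{C}) : {}^tZ=Z,\ \mathrm{Im}(Z)>0\}$, $\Gamma=\mathrm{Sp}_4(\mathbb{Z})$ acts on it by $\gamma Z=(AZ+B)(CZ+D)^{-1}$ for $\gamma=\begin{pmatrix}A&B\\C&D\end{pmatrix}$ ($2\times 2$ blocks), $j(\gamma,Z)=\det(CZ+D)$, and $\Gamma_\infty=\{\gamma\in\Gamma : C=0\}$. For even $k\ge 4$, $E_k(Z)=\sum_{\gamma\in\Gamma_\infty\backslash\Gamma} j(\gamma,Z)^{-k}$ and $G_k(Z)=\tfrac12\zeta(1-k)\zeta(3-2k)E_k(Z)$, with $\zeta$ the Riemann zeta function. When $p-1>2k-2$, all Fourier coefficients of $G_k$ lie in $\mathbb{Z}_p$. A degree 2 Siegel modular form for $\Gamma$ has Fourier expansion $F(Z)=\sum_{T}A_F(T)q^T$, $q^T=\exp(2\pi\sqrt{-1}\,\mathrm{tr}(TZ))$, where $T$ runs over positive semi-definite symmetric $2\times2$ matrices with integral diagonal and half-integral off-diagonal entries. A form $F$ with $A_F(T)\in\mathcal{O}_K$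 for all $T$ ($K$ a number field, $\mathcal{O}_K$ its ring of integers) is congruent to $G$ modulo a prime $\mathcal{P}$ of $\mathcal{O}_K$ above $p$ if $A_F(T)\equiv A_G(T)$ mod $\mathcal{P}$ for all $T$ (congruence in the localization or completion of $\mathcal{O}_K$ at $\mathcal{P}$). A Hecke eigen form is a nonzero simultaneous eigenfunction of all Hecke operators of $\Gamma$. $B_n$ is the $n$-th Bernoulli number. $h_p^+$ is (the order of) the plus part of the ideal class group of $\mathbb{Q}(\zeta_p)$, i.e. the class number of its maximal real subfield, with $\zeta_p$ a primitive $p$-th root of unity. Vandiver's conjecture asserts $p\nmid h_p^+$ for every prime $p$. *)

theory Defs
  imports
    "HOL-Analysis.Analysis"
    "HOL-Computational_Algebra.Computational_Algebra"
    "HOL-Algebra.Algebraic_Closure_Type"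
    "HOL-Algebra.Embedded_Algebras"
    "HOL-Algebra.Generated_Fields"
    "HOL-Algebra.Ideal_Product"
    "HOL-Algebra.Coset"
begin

unbundle no fps_syntax

section \<open>The symplectic group and the Siegel upper half space of degree 2\<close>

definition siegel_H2 :: "(complex^2^2) set" where
  "siegel_H2 = {Z. transpose Z = Z \<and>
     (\<forall>x::real^2. x \<noteq> 0 \<longrightarrow> x \<bullet> ((\<chi> i j. Im (Z $ i $ j)) *v x) > 0)}"

text \<open>A real $4\times4$ matrix is indexed by the sum type \<open>2 + 2\<close>, so that the four
  $2\times2$ blocks are obtained by restricting the row and column indices to
  \<^const>\<open>Inl\<close> and \<^const>\<open>Inr\<close>.\<close>

type_synonym mat4 = "real^(2 + 2)^(2 + 2)"

definition block_A :: "mat4 \<Rightarrow> complex^2^2" where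
  "block_A M = (\<chi> i j. of_real (M $ Inl i $ Inl j))"

definition block_B :: "mat4 \<Rightarrow> complex^2^2" where
  "block_B M = (\<chi> i j. of_real (M $ Inl i $ Inr j))"

definition block_C :: "mat4 \<Rightarrow> complex^2^2" where
  "block_C M = (\<chi> i j. of_real (M $ Inr i $ Inl j))"

definition block_D :: "mat4 \<Rightarrow> complex^2^2" where
  "block_D M = (\<chi> i j. of_real (M $ Inr i $ Inr j))"

definition symplectic_J :: mat4 where
  "symplectic_J = (\<chi> a b. case (a, b) of
      (Inl i, Inr j) \<Rightarrow> (if i = j then 1 else 0)
    | (Inr i, Inl j) \<Rightarrow> (if i = j then - 1 else 0)
    | _ \<Rightarrow> 0)"

definition Sp4_Z :: "mat4 set" where
  "Sp4_Z = {M. (\<forall>a b. M $ a $ b \<in> \<int>) \<and>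
               transpose M ** symplectic_J ** M = symplectic_J}"

definition Sp4_Z_inf :: "mat4 set" where
  "Sp4_Z_inf = {M \<in> Sp4_Z. block_C M = 0}"

definition GSp4_Q_plus :: "mat4 set" where
  "GSp4_Q_plus = {M. (\<forall>a b. M $ a $ b \<in> \<rat>) \<and>
     (\<exists>\<nu>>0. transpose M ** symplectic_J ** M = \<nu> *\<^sub>R symplectic_J)}"

definition similitude :: "mat4 \<Rightarrow> real" where
  "similitude M = (THE \<nu>. transpose M ** symplectic_J ** M = \<nu> *\<^sub>R symplectic_J)"

definition siegel_act :: "mat4 \<Rightarrow> complex^2^2 \<Rightarrow> complex^2^2" where
  "siegel_act M Z = (block_A M ** Z + block_B M) ** matrix_inv (block_C M ** Z + block_D M)"

definition siegel_j :: "mat4 \<Rightarrow> complex^2^2 \<Rightarrow> complex" where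
  "siegel_j M Z = det (block_C M ** Z + block_D M)"

text \<open>The set of cosets \<open>H g\<close> with \<open>g \<in> S\<close>; it is the quotient \<open>H\S\<close>
  when \<open>S\<close> is stable under left multiplication by \<open>H\<close>.\<close>

definition left_quotient :: "mat4 set \<Rightarrow> mat4 set \<Rightarrow> mat4 set set" where
  "left_quotient H S = (\<lambda>g. (\<lambda>h. h ** g) ` H) ` S"


section \<open>Siegel modular forms of degree 2 for the full modular group\<close>

text \<open>\<^const>\<open>siegel_H2\<close> is open in the 3-dimensional complex space of symmetric matrices, so
  only the restriction of the derivative \<open>D\<close> to that space is determined; every complex
  linear map on it extends to a complex linear map on all matrices.  The matrix
  \<open>mat c ** W\<close> is the scalar multiple of \<open>W\<close> by the complex number \<open>c\<close>.\<close>

definition siegel_holomorphic :: "(complex^2^2 \<Rightarrow> complex) \<Rightarrow> bool" where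
  "siegel_holomorphic F \<longleftrightarrow>
     (\<forall>Z\<in>siegel_H2. \<exists>D. (F has_derivative D) (at Z within siegel_H2) \<and>
        (\<forall>c W. D (mat c ** W) = c * D W))"

text \<open>No condition at the cusp is needed in degree 2 (Koecher principle).\<close>

definition siegel_modular_form :: "nat \<Rightarrow> (complex^2^2 \<Rightarrow> complex) \<Rightarrow> bool" where
  "siegel_modular_form k F \<longleftrightarrow> siegel_holomorphic F \<and>
     (\<forall>M\<in>Sp4_Z. \<forall>Z\<in>siegel_H2. F (siegel_act M Z) = siegel_j M Z ^ k * F Z)"

text \<open>Cusp forms are the kernel of the Siegel operator
  $(\Phi F)(\tau) = \lim_{t\to\infty} F(\mathrm{diag}(\tau, it))$.\<close>

definition siegel_cusp_form :: "nat \<Rightarrow> (complex^2^2 \<Rightarrow> complex) \<Rightarrow> bool" where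
  "siegel_cusp_form k F \<longleftrightarrow> siegel_modular_form k F \<and>
     (\<forall>\<tau>. Im \<tau> > 0 \<longrightarrow>
        ((\<lambda>t::real. F (vector [vector [\<tau>, 0], vector [0, \<i> * of_real t]])) \<longlongrightarrow> 0) at_top)"

definition siegel_slash ::
  "nat \<Rightarrow> (complex^2^2 \<Rightarrow> complex) \<Rightarrow> mat4 \<Rightarrow> complex^2^2 \<Rightarrow> complex" where
  "siegel_slash k F M Z =
     of_real (similitude M) powi (2 * int k - 3) * inverse (siegel_j M Z ^ k) * F (siegel_act M Z)"

text \<open>The operator of the double coset \<open>\<Gamma> g \<Gamma>\<close>.  On modular forms of weight \<open>k\<close> the summand
  depends only on the coset \<open>\<Gamma> h\<close>, so the choice of representatives is immaterial; the
  number of cosets is finite for \<open>g\<close> in \<^const>\<open>GSp4_Q_plus\<close>.  These operators span the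
  algebra of all Hecke operators.\<close>

definition hecke_operator ::
  "nat \<Rightarrow> mat4 \<Rightarrow> (complex^2^2 \<Rightarrow> complex) \<Rightarrow> complex^2^2 \<Rightarrow> complex" where
  "hecke_operator k g F Z =
     (\<Sum>C\<in>left_quotient Sp4_Z {a ** g ** b | a b. a \<in> Sp4_Z \<and> b \<in> Sp4_Z}.
        siegel_slash k F (SOME h. h \<in> C) Z)"

definition hecke_eigenform :: "nat \<Rightarrow> (complex^2^2 \<Rightarrow> complex) \<Rightarrow> bool" where
  "hecke_eigenform k F \<longleftrightarrow> siegel_modular_form k F \<and> (\<exists>Z\<in>siegel_H2. F Z \<noteq> 0) \<and>
     (\<forall>g\<in>GSp4_Q_plus. \<exists>\<mu>. \<forall>Z\<in>siegel_H2. hecke_operator k g F Z = \<mu> * F Z)"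


section \<open>Fourier expansions\<close>

definition half_integral_psd :: "(real^2^2) set" where
  "half_integral_psd = {T. transpose T = T \<and> (\<forall>i. T $ i $ i \<in> \<int>) \<and>
     (\<forall>i j. 2 * T $ i $ j \<in> \<int>) \<and> (\<forall>x. x \<bullet> (T *v x) \<ge> 0)}"

definition q_exp :: "real^2^2 \<Rightarrow> complex^2^2 \<Rightarrow> complex" where
  "q_exp T Z = exp (2 * of_real pi * \<i> * trace ((\<chi> i j. of_real (T $ i $ j)) ** Z))"

text \<open>\<open>A\<close> is the family of Fourier coefficients \<open>A\<^sub>F(T)\<close> of \<open>F\<close>.  It is unique, and it
  exists for every Siegel modular form.\<close>

definition has_fourier_expansion ::
  "(complex^2^2 \<Rightarrow> complex) \<Rightarrow> (real^2^2 \<Rightarrow> complex) \<Rightarrow> bool" where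
  "has_fourier_expansion F A \<longleftrightarrow>
     (\<forall>Z\<in>siegel_H2. ((\<lambda>T. A T * q_exp T Z) has_sum F Z) half_integral_psd)"


section \<open>The Eisenstein series\<close>

definition bernoulli_number :: "nat \<Rightarrow> rat" where
  "bernoulli_number n = fact n * fps_nth (fps_X / (fps_exp 1 - 1)) n"

text \<open>The analytic continuation of the Dirichlet series; it is unique on \<open>- {1}\<close>.\<close>

definition riemann_zeta :: "complex \<Rightarrow> complex" where
  "riemann_zeta = (SOME f. f holomorphic_on - {1} \<and>
     (\<forall>s. Re s > 1 \<longrightarrow> (\<lambda>n. of_nat (Suc n) powr (- s)) sums f s))"

text \<open>For even \<open>k\<close> the summand depends only on the coset, as \<open>det D = \<plusminus>1\<close> on
  \<^const>\<open>Sp4_Z_inf\<close>; for \<open>k \<ge> 4\<close> the series converges absolutely.\<close>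

definition siegel_E :: "nat \<Rightarrow> complex^2^2 \<Rightarrow> complex" where
  "siegel_E k Z =
     (\<Sum>\<^sub>\<infinity>C\<in>left_quotient Sp4_Z_inf Sp4_Z. inverse (siegel_j (SOME M. M \<in> C) Z ^ k))"

definition siegel_G :: "nat \<Rightarrow> complex^2^2 \<Rightarrow> complex" where
  "siegel_G k Z =
     1 / 2 * riemann_zeta (1 - of_nat k) * riemann_zeta (3 - 2 * of_nat k) * siegel_E k Z"


section \<open>Number fields and class numbers\<close>

text \<open>Number fields are taken inside the complex numbers, where Fourier coefficients live.\<close>

abbreviation complex_ring :: "complex ring" where
  "complex_ring \<equiv> ring_of_type_algebra"

definition number_field :: "complex set \<Rightarrow> bool" where
  "number_field K \<longleftrightarrow> subfield K complex_ring \<and> ring.finite_dimension complex_ring \<rat> K"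

definition integers_of :: "complex set \<Rightarrow> complex set" where
  "integers_of K = {x \<in> K. algebraic_int x}"

abbreviation ring_of_integers :: "complex set \<Rightarrow> complex ring" where
  "ring_of_integers K \<equiv> complex_ring\<lparr>carrier := integers_of K\<rparr>"

definition prime_above :: "nat \<Rightarrow> complex set \<Rightarrow> complex set \<Rightarrow> bool" where
  "prime_above p K P \<longleftrightarrow> primeideal P (ring_of_integers K) \<and> of_nat p \<in> P"

text \<open>The maximal ideal of the localization of the ring of integers at the prime ideal \<open>P\<close>.\<close>

definition local_max_ideal :: "complex set \<Rightarrow> complex set \<Rightarrow> complex set" where
  "local_max_ideal K P = {a / s | a s. a \<in> P \<and> s \<in> integers_of K - P}"

definition siegel_congruent ::
  "complex set \<Rightarrow> complex set \<Rightarrow> (complex^2^2 \<Rightarrow> complex) \<Rightarrow> (complex^2^2 \<Rightarrow> complex) \<Rightarrow> bool" where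
  "siegel_congruent K P F G \<longleftrightarrow>
     (\<exists>A B. has_fourier_expansion F A \<and> has_fourier_expansion G B \<and>
        (\<forall>T\<in>half_integral_psd. A T \<in> integers_of K) \<and>
        (\<forall>T\<in>half_integral_psd. A T - B T \<in> local_max_ideal K P))"

definition fractional_ideal :: "complex set \<Rightarrow> complex set \<Rightarrow> bool" where
  "fractional_ideal K I \<longleftrightarrow> I \<subseteq> K \<and> 0 \<in> I \<and> I \<noteq> {0} \<and>
     (\<forall>x\<in>I. \<forall>y\<in>I. x + y \<in> I) \<and> (\<forall>a\<in>integers_of K. \<forall>x\<in>I. a * x \<in> I) \<and>
     (\<exists>d\<in>integers_of K - {0}. \<forall>x\<in>I. d * x \<in> integers_of K)"

definition ideal_group :: "complex set \<Rightarrow> complex set monoid" where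
  "ideal_group K = \<lparr>carrier = {I. fractional_ideal K I},
     mult = ideal_prod complex_ring, one = integers_of K\<rparr>"

definition principal_ideals :: "complex set \<Rightarrow> complex set set" where
  "principal_ideals K = {(\<lambda>x. a * x) ` integers_of K | a. a \<in> K - {0}}"

definition class_number :: "complex set \<Rightarrow> nat" where
  "class_number K = Coset.order (ideal_group K Mod principal_ideals K)"

definition cyclotomic_field :: "nat \<Rightarrow> complex set" where
  "cyclotomic_field p = generate_field complex_ring {cis (2 * pi / real p)}"

definition h_plus :: "nat \<Rightarrow> nat" where
  "h_plus p = class_number (cyclotomic_field p \<inter> \<real>)"

definition vandiver_conjecture :: bool where
  "vandiver_conjecture \<longleftrightarrow> (\<forall>p. Factorial_Ring.prime p \<longrightarrow> \<not> p dvd h_plus p)"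

definition ord_p :: "nat \<Rightarrow> rat \<Rightarrow> ereal" where
  "ord_p p x = (if x = 0 then \<infinity> else
     ereal (of_int (int (multiplicity (int p) (fst (quotient_of x))) -
                    int (multiplicity (int p) (snd (quotient_of x))))))"

end

theory Submission
  imports Defs "HOL-Complex_Analysis.Complex_Analysis"
begin

(* The dollar sign is reserved for vector components. *)
unbundle no Formal_Power_Series.fps_syntax

text \<open>
  The congruence is required of all Fourier coefficients, so in particular of the constant term,
  and the constant terms alone exclude it.  A cusp form \<open>F\<close> has \<open>A\<^sub>F(0) = 0\<close>, whereas the constant
  term of \<open>G\<^sub>k\<close> is
  \<open>\<zeta>(1 - k) \<zeta>(3 - 2k) / 2 = B\<^sub>k B\<^sub>2\<^sub>k\<^sub>-\<^sub>2 / (2k (2k - 2))\<close>.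
  If \<open>B\<^sub>k B\<^sub>2\<^sub>k\<^sub>-\<^sub>2\<close> times a positive integer has \<open>p\<close>-adic order \<open>0\<close>, then \<open>p\<close> does not divide the
  reduced numerator of \<open>B\<^sub>k B\<^sub>2\<^sub>k\<^sub>-\<^sub>2\<close>, and dividing by integers does not create a factor \<open>p\<close> in the
  numerator.  Hence the difference of the constant terms cannot lie in the maximal ideal at a prime
  above \<open>p\<close> (\<open>local_max_ideal_numerator\<close>).

  The work is to establish the two constant terms from the analytic definitions.  Both are limits
  along \<open>Z = diag(iy, it)\<close>, computed by dominated convergence (\<open>tannery\<close>): a Fourier series tends
  to its constant term along \<open>Z = iy\<close>, and for a cusp form one lets first \<open>t\<close> and then \<open>y\<close> tend
  to infinity.

  For the Eisenstein series the coset of \<open>(C, D)\<close> is determined by the \<open>2 \<times> 2\<close> minors of the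
  matrix \<open>(C D)\<close>, which are integers \<open>(a, b, c, d, e)\<close> on the quadric \<open>ab + cd + e\<^sup>2 = 0\<close>, and
  \<open>\<bar>det (iyC + D)\<bar>\<^sup>2 = b\<^sup>2 + y\<^sup>4 a\<^sup>2 + y\<^sup>2 (c\<^sup>2 + d\<^sup>2 + 2 e\<^sup>2)\<close>.
  So the series is dominated by a sum over integral points of this quadric.  The number of
  points of size at most \<open>X\<close> is \<open>X\<^sup>3\<close> up to logarithms, so the sum of \<open>\<bar>x\<bar>\<^sup>-\<^sup>k\<close> converges for \<open>k \<ge> 4\<close>
  (\<open>summable_on_quadric\<close>); as \<open>y\<close> grows only the coset with \<open>C = 0\<close> survives and \<open>E\<^sub>k(iy) \<rightarrow> 1\<close>.

  The zeta values come from a discrete form of Euler-Maclaurin summation, in which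
  \<open>(s - 1) \<zeta>(s)\<close> is continued to every half plane by a series of elementary functions
  (\<open>zeta_numerator\<close>); at \<open>s = 1 - N\<close> that series vanishes term by term and leaves \<open>B\<^sub>N\<close>.
\<close>

section \<open>Dominated convergence for unordered sums\<close>

text \<open>A finite partial sum approximates all dominated families at once, because the Weierstrass M-test
  is uniform over the set of functions bounded by \<open>M\<close>; on a finite set the limit can be taken
  term by term.\<close>

lemma tannery:
  fixes f :: "'b \<Rightarrow> 'a \<Rightarrow> 'c :: banach"
  assumes lim: "\<And>i. i \<in> S \<Longrightarrow> ((\<lambda>t. f t i) \<longlongrightarrow> g i) F"
    and bound: "eventually (\<lambda>t. \<forall>i\<in>S. norm (f t i) \<le> M i) F"
    and M: "M summable_on S" and F: "F \<noteq> bot"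
  shows "((\<lambda>t. infsum (f t) S) \<longlongrightarrow> infsum g S) F"
proof -
  define Y where "Y = {h :: 'a \<Rightarrow> 'c. \<forall>i\<in>S. norm (h i) \<le> M i}"
  have fY: "eventually (\<lambda>t. f t \<in> Y) F"
    using bound by (simp add: Y_def)
  have gY: "g \<in> Y"
    unfolding Y_def
  proof (intro CollectI ballI)
    fix i assume "i \<in> S"
    then show "norm (g i) \<le> M i"
      using bound by (intro tendsto_upperbound[OF tendsto_norm[OF lim] _ F]) (auto elim: eventually_mono)
  qed
  have ul: "uniform_limit Y (\<lambda>I h. \<Sum>i\<in>I. h i) (\<lambda>h. \<Sum>\<^sub>\<infinity>i\<in>S. h i) (finite_subsets_at_top S)"
    by (rule Weierstrass_m_test_general[OF _ M]) (auto simp: Y_def)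
  show ?thesis
  proof (rule tendstoI)
    fix e :: real assume e: "e > 0"
    have "eventually (\<lambda>I. (finite I \<and> I \<subseteq> S) \<and> (\<forall>h\<in>Y. dist (\<Sum>i\<in>I. h i) (infsum h S) < e / 3))
            (finite_subsets_at_top S)"
    proof (rule eventually_conj)
      show "eventually (\<lambda>I. finite I \<and> I \<subseteq> S) (finite_subsets_at_top S)"
        by (rule eventually_finite_subsets_at_top_weakI) simp
      show "eventually (\<lambda>I. \<forall>h\<in>Y. dist (\<Sum>i\<in>I. h i) (infsum h S) < e / 3) (finite_subsets_at_top S)"
        using e by (intro uniform_limitD[OF ul]) simp
    qed
    from eventually_happens'[OF finite_subsets_at_top_neq_bot this]
    obtain I where I: "finite I" "I \<subseteq> S"
      and close: "\<And>h. h \<in> Y \<Longrightarrow> dist (\<Sum>i\<in>I. h i) (infsum h S) < e / 3"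
      by blast
    have "((\<lambda>t. \<Sum>i\<in>I. f t i) \<longlongrightarrow> (\<Sum>i\<in>I. g i)) F"
      using I lim by (intro tendsto_sum) auto
    then have "eventually (\<lambda>t. dist (\<Sum>i\<in>I. f t i) (\<Sum>i\<in>I. g i) < e / 3) F"
      using e by (intro tendstoD) auto
    then show "eventually (\<lambda>t. dist (infsum (f t) S) (infsum g S) < e) F"
      using fY
    proof eventually_elim
      case (elim t)
      have "dist (infsum (f t) S) (infsum g S) \<le> dist (\<Sum>i\<in>I. f t i) (infsum (f t) S)
          + dist (\<Sum>i\<in>I. f t i) (\<Sum>i\<in>I. g i) + dist (\<Sum>i\<in>I. g i) (infsum g S)"
        by metric
      with close[OF elim(2)] close[OF gY] elim(1) show ?case by linarith
    qed
  qed
qed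

lemma exp_weight_tendsto:
  fixes w :: real
  assumes "w \<ge> 0"
  shows "((\<lambda>t. exp (- (t * w))) \<longlongrightarrow> (if w = 0 then 1 else 0)) at_top"
proof (cases "w = 0")
  case False
  with assms have "w > 0" by simp
  then have "filterlim (\<lambda>t. t * w) at_top at_top"
    using filterlim_at_top_mult_tendsto_pos[OF tendsto_const _ filterlim_ident] by fast
  then have "filterlim (\<lambda>t. - (t * w)) at_bot at_top"
    by (simp only: filterlim_uminus_at_top)
  then have "((\<lambda>t. exp (- (t * w))) \<longlongrightarrow> 0) at_top"
    by (rule filterlim_compose[OF exp_at_bot])
  with False show ?thesis by simp
qed auto

text \<open>The terms of weight \<open>0\<close> are constant and all others decay; the absolute values at \<open>t = 1\<close>
  dominate the sum for \<open>t \<ge> 1\<close>.\<close>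

lemma exponential_sum_tendsto:
  fixes a :: "'i \<Rightarrow> complex" and w :: "'i \<Rightarrow> real"
  assumes w: "\<And>i. i \<in> S \<Longrightarrow> w i \<ge> 0"
    and sum: "\<And>t. t > 0 \<Longrightarrow> ((\<lambda>i. a i * of_real (exp (- (t * w i)))) has_sum f t) S"
  shows "(f \<longlongrightarrow> infsum a {i\<in>S. w i = 0}) at_top"
proof -
  have "((\<lambda>t. \<Sum>\<^sub>\<infinity>i\<in>S. a i * of_real (exp (- (t * w i)))) \<longlongrightarrow>
         (\<Sum>\<^sub>\<infinity>i\<in>S. a i * of_real (if w i = 0 then 1 else 0))) at_top"
  proof (rule tannery[where M = "\<lambda>i. norm (a i * of_real (exp (- (1 * w i))))"])
    show "((\<lambda>t. a i * of_real (exp (- (t * w i)))) \<longlongrightarrow> a i * of_real (if w i = 0 then 1 else 0)) at_top"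
      if "i \<in> S" for i
      by (intro tendsto_intros exp_weight_tendsto w that)
    show "eventually (\<lambda>t. \<forall>i\<in>S. norm (a i * complex_of_real (exp (- (t * w i))))
            \<le> norm (a i * complex_of_real (exp (- (1 * w i))))) at_top"
      using eventually_ge_at_top[of 1]
    proof eventually_elim
      case (elim t)
      have "exp (- (t * w i)) \<le> exp (- (1 * w i))" if "i \<in> S" for i
        using elim w[OF that] by (simp add: mult_right_mono mult_le_cancel_right1)
      then show ?case by (auto simp: norm_mult intro!: mult_left_mono)
    qed
    show "(\<lambda>i. norm (a i * complex_of_real (exp (- (1 * w i))))) summable_on S"
      using sum[of 1] summable_on_iff_abs_summable_on_complex has_sum_imp_summable by force
  qed auto
  also have "(\<Sum>\<^sub>\<infinity>i\<in>S. a i * of_real (if w i = 0 then 1 else 0)) = infsum a {i\<in>S. w i = 0}"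
    by (rule infsum_cong_neutral) auto
  finally have "((\<lambda>t. \<Sum>\<^sub>\<infinity>i\<in>S. a i * of_real (exp (- (t * w i)))) \<longlongrightarrow> infsum a {i\<in>S. w i = 0}) at_top" .
  moreover have "\<forall>\<^sub>F t in at_top. (\<Sum>\<^sub>\<infinity>i\<in>S. a i * of_real (exp (- (t * w i)))) = f t"
    using eventually_gt_at_top[of 0] by eventually_elim (rule infsumI[OF sum])
  ultimately show ?thesis
    by (rule Lim_transform_eventually)
qed

section \<open>Constant terms of Fourier expansions\<close>

text \<open>The factor \<open>\<i>\<close> is built in: the parameters are the imaginary parts, so that \<open>diag_point y y\<close> is
  the scalar matrix \<open>iy\<close>.\<close>

definition diag_point :: "real \<Rightarrow> real \<Rightarrow> complex^2^2" where
  "diag_point y t = vector [vector [\<i> * of_real y, 0], vector [0, \<i> * of_real t]]"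

lemma diag_point_nth [simp]:
  "diag_point y t $ 1 $ 1 = \<i> * of_real y" "diag_point y t $ 1 $ 2 = 0"
  "diag_point y t $ 2 $ 1 = 0" "diag_point y t $ 2 $ 2 = \<i> * of_real t"
  by (simp_all add: diag_point_def)

lemma diag_point_in_H2:
  assumes "y > 0" "t > 0"
  shows "diag_point y t \<in> siegel_H2"
proof -
  have "transpose (diag_point y t) = diag_point y t"
    by (simp add: vec_eq_iff transpose_def forall_2)
  moreover have "x \<bullet> ((\<chi> i j. Im (diag_point y t $ i $ j)) *v x) > 0" if "x \<noteq> 0" for x :: "real^2"
  proof -
    have "x \<bullet> ((\<chi> i j. Im (diag_point y t $ i $ j)) *v x) = y * (x $ 1)\<^sup>2 + t * (x $ 2)\<^sup>2"
      by (simp add: inner_vec_def matrix_vector_mult_def sum_2 power2_eq_square)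
    moreover have "x $ 1 \<noteq> 0 \<or> x $ 2 \<noteq> 0"
      using that by (auto simp: vec_eq_iff forall_2)
    ultimately show ?thesis
      using assms by (auto intro: add_pos_nonneg add_nonneg_pos)
  qed
  ultimately show ?thesis by (simp add: siegel_H2_def)
qed

lemma q_exp_diag_point:
  "q_exp T (diag_point y t) = of_real (exp (- (2 * pi * (y * T $ 1 $ 1 + t * T $ 2 $ 2))))"
proof -
  have "2 * of_real pi * \<i> * trace ((\<chi> i j. of_real (T $ i $ j)) ** diag_point y t) =
      of_real (- (2 * pi * (y * T $ 1 $ 1 + t * T $ 2 $ 2)))"
    by (simp add: trace_def matrix_matrix_mult_def sum_2 algebra_simps)
  then show ?thesis
    unfolding q_exp_def by (simp only: exp_of_real)
qed

lemma half_integral_psd_diag_nonneg: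
  assumes "T \<in> half_integral_psd"
  shows "(T :: real^2^2) $ i $ i \<ge> 0"
proof -
  have "axis i 1 \<bullet> (T *v axis i 1) \<ge> 0"
    using assms by (simp add: half_integral_psd_def)
  then show ?thesis by (simp add: matrix_vector_mult_basis inner_axis' column_def)
qed

text \<open>Evaluating the quadratic form at \<open>(1, 1)\<close> and \<open>(1, -1)\<close> bounds the off-diagonal entry from
  both sides.\<close>

lemma half_integral_psd_diag_zero:
  fixes T :: "real^2^2"
  assumes T: "T \<in> half_integral_psd" and d: "T $ 1 $ 1 = 0" "T $ 2 $ 2 = 0"
  shows "T = 0"
proof -
  have sym: "T $ 2 $ 1 = T $ 1 $ 2"
    using T by (auto simp: half_integral_psd_def transpose_def vec_eq_iff)
  have psd: "x \<bullet> (T *v x) \<ge> 0" for x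
    using T by (simp add: half_integral_psd_def)
  have "T $ 1 $ 2 = 0"
    using psd[of "vector [1, 1]"] psd[of "vector [1, -1]"]
    by (simp add: inner_vec_def matrix_vector_mult_def sum_2 d sym)
  with d sym show ?thesis by (simp add: vec_eq_iff forall_2)
qed

lemma zero_in_half_integral_psd: "0 \<in> half_integral_psd"
  by (simp add: half_integral_psd_def transpose_def vec_eq_iff)

lemma constant_term_eq_limit:
  assumes A: "has_fourier_expansion F A"
  shows "((\<lambda>y. F (diag_point y y)) \<longlongrightarrow> A 0) at_top"
proof -
  let ?w = "\<lambda>T :: real^2^2. 2 * pi * (T $ 1 $ 1 + T $ 2 $ 2)"
  have "((\<lambda>y. F (diag_point y y)) \<longlongrightarrow> infsum A {T\<in>half_integral_psd. ?w T = 0}) at_top"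
  proof (rule exponential_sum_tendsto)
    show "?w T \<ge> 0" if "T \<in> half_integral_psd" for T
      using half_integral_psd_diag_nonneg[OF that] by simp
    show "((\<lambda>T. A T * of_real (exp (- (y * ?w T)))) has_sum F (diag_point y y)) half_integral_psd"
      if "y > 0" for y
    proof -
      have "((\<lambda>T. A T * q_exp T (diag_point y y)) has_sum F (diag_point y y)) half_integral_psd"
        using A diag_point_in_H2[OF that that] by (simp add: has_fourier_expansion_def)
      then show ?thesis
        unfolding q_exp_diag_point by (simp only: algebra_simps)
    qed
  qed
  also have "{T\<in>half_integral_psd. ?w T = 0} = {0}"
    using half_integral_psd_diag_nonneg half_integral_psd_diag_zero zero_in_half_integral_psd
    by (auto simp: add_nonneg_eq_0_iff)
  finally show ?thesis by simp
qed

text \<open>The cusp condition is pointwise in \<open>\<tau>\<close>, so the limit is taken in two stages.  The limit in \<open>t\<close>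
  leaves the sum over \<open>T\<close> with vanishing second diagonal entry, which is \<open>0\<close> for every \<open>\<tau> = iy\<close>;
  letting \<open>y\<close> tend to infinity in this identity isolates \<open>T = 0\<close>.\<close>

lemma cusp_form_constant_term:
  assumes F: "siegel_cusp_form k F" and A: "has_fourier_expansion F A"
  shows "A 0 = 0"
proof -
  define S where "S = {T\<in>half_integral_psd. 2 * pi * (T :: real^2^2) $ 2 $ 2 = 0}"
  have expansion: "((\<lambda>T. A T * of_real (exp (- (y * (2 * pi * T $ 1 $ 1)))) *
        of_real (exp (- (t * (2 * pi * T $ 2 $ 2))))) has_sum F (diag_point y t)) half_integral_psd"
    if "y > 0" "t > 0" for y t
  proof -
    have "((\<lambda>T. A T * q_exp T (diag_point y t)) has_sum F (diag_point y t)) half_integral_psd"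
      using A diag_point_in_H2[OF that] by (simp add: has_fourier_expansion_def)
    moreover have "A T * q_exp T (diag_point y t) = A T * of_real (exp (- (y * (2 * pi * T $ 1 $ 1)))) *
        of_real (exp (- (t * (2 * pi * T $ 2 $ 2))))" for T
      unfolding q_exp_diag_point by (simp add: algebra_simps flip: exp_add of_real_mult)
    ultimately show ?thesis by simp
  qed
  have zero: "((\<lambda>T. A T * of_real (exp (- (y * (2 * pi * T $ 1 $ 1))))) has_sum 0) S"
    if y: "y > 0" for y
  proof -
    let ?a = "\<lambda>T :: real^2^2. A T * of_real (exp (- (y * (2 * pi * T $ 1 $ 1))))"
    have "((\<lambda>t. F (diag_point y t)) \<longlongrightarrow> infsum ?a S) at_top"
      unfolding S_def using expansion[OF y] half_integral_psd_diag_nonneg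
      by (intro exponential_sum_tendsto) auto
    moreover have "((\<lambda>t. F (diag_point y t)) \<longlongrightarrow> 0) at_top"
      using F y by (auto simp: siegel_cusp_form_def diag_point_def)
    ultimately have zero: "infsum ?a S = 0"
      using tendsto_unique trivial_limit_at_top_linorder by blast
    have "?a summable_on S"
    proof -
      have "(\<lambda>T. ?a T * of_real (exp (- (1 * (2 * pi * T $ 2 $ 2))))) summable_on half_integral_psd"
        using expansion[OF y, of 1] has_sum_imp_summable by force
      then have "(\<lambda>T. ?a T * of_real (exp (- (1 * (2 * pi * T $ 2 $ 2))))) summable_on S"
        by (rule summable_on_subset_banach) (auto simp: S_def)
      then show ?thesis
        by (rule summable_on_cong[THEN iffD1, rotated]) (auto simp: S_def)
    qed
    then have "(?a has_sum infsum ?a S) S"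
      by (rule has_sum_infsum)
    then show ?thesis
      unfolding zero .
  qed
  have "((\<lambda>y :: real. 0) \<longlongrightarrow> infsum A {T\<in>S. 2 * pi * T $ 1 $ 1 = 0}) at_top"
    by (rule exponential_sum_tendsto) (use zero half_integral_psd_diag_nonneg in \<open>auto simp: S_def\<close>)
  then have "infsum A {T\<in>S. 2 * pi * T $ 1 $ 1 = 0} = 0"
    by (simp add: tendsto_const_iff)
  moreover have "{T\<in>S. 2 * pi * T $ 1 $ 1 = 0} = {0}"
    using half_integral_psd_diag_zero zero_in_half_integral_psd by (auto simp: S_def)
  ultimately show ?thesis by simp
qed

section \<open>Values of the Riemann zeta function at negative integers\<close>

text \<open>Comparison of coefficients in \<open>(x / (e\<^sup>x - 1)) (e\<^sup>x - 1) = x\<close>.  The quotient of formal power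
  series is exact because \<open>e\<^sup>x - 1\<close> has order \<open>1\<close>.\<close>

lemma bernoulli_recursion:
  "(\<Sum>j<l. of_nat (l choose j) * bernoulli_number j) = (if l = 1 then 1 else 0)"
proof -
  let ?b = "fps_X / (fps_exp 1 - 1) :: rat fps"
  have sub: "subdegree (fps_exp 1 - 1 :: rat fps) = 1"
    by (rule subdegreeI) (auto simp: fps_exp_def)
  have "(fps_exp 1 - 1 :: rat fps) dvd fps_X"
    by (subst fps_dvd_iff) (use sub in auto)
  then have prod: "?b * (fps_exp 1 - 1) = fps_X"
    by (rule dvd_div_mult_self)
  have "(\<Sum>j<l. of_nat (l choose j) * bernoulli_number j) =
      fact l * (\<Sum>j=0..l. fps_nth ?b j * fps_nth (fps_exp 1 - 1) (l - j))"
  proof -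
    have eq: "of_nat (l choose j) * bernoulli_number j =
        fact l * (fps_nth ?b j * fps_nth (fps_exp 1 - 1) (l - j))" if "j < l" for j
      using that by (simp add: bernoulli_number_def binomial_fact)
    have "(\<Sum>j=0..l. fps_nth ?b j * fps_nth (fps_exp 1 - 1) (l - j)) =
        (\<Sum>j<l. fps_nth ?b j * fps_nth (fps_exp 1 - 1) (l - j))"
      by (rule sum.mono_neutral_right) auto
    then show ?thesis by (simp add: sum_distrib_left eq)
  qed
  also have "\<dots> = fact l * fps_nth (?b * (fps_exp 1 - 1)) l"
    by (simp only: fps_mult_nth)
  also have "\<dots> = (if l = 1 then 1 else 0)"
    unfolding prod by (simp add: fps_X_def)
  finally show ?thesis .
qed

text \<open>For \<open>w = N \<le> m\<close> this is the Bernoulli polynomial \<open>B\<^sub>N(x)\<close>; for other \<open>w\<close> it is a truncation of its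
  asymptotic expansion.  It solves \<open>f(x + 1) - f(x) = w x\<^sup>w\<^sup>-\<^sup>1\<close> up to \<open>power_defect\<close>, which is of
  order \<open>x\<^sup>w\<^sup>-\<^sup>m\<^sup>-\<^sup>1\<close>.\<close>

definition bernoulli_power :: "nat \<Rightarrow> complex \<Rightarrow> real \<Rightarrow> complex" where
  "bernoulli_power m w x =
     (\<Sum>j\<le>m. of_rat (bernoulli_number j) * (w gchoose j) * of_real x powr (w - of_nat j))"

definition power_defect :: "nat \<Rightarrow> complex \<Rightarrow> real \<Rightarrow> complex" where
  "power_defect m w x =
     bernoulli_power m w (x + 1) - bernoulli_power m w x - w * of_real x powr (w - 1)"

lemma gbinomial_product:
  fixes w :: complex
  shows "(w gchoose j) * ((w - of_nat j) gchoose l) = (w gchoose (j + l)) * of_nat ((j + l) choose j)"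
  using gbinomial_trinomial_revision[of j "j + l" w] by (simp add: binomial_gbinomial)

text \<open>Expanding every \<open>(x + 1)\<^sup>w\<^sup>-\<^sup>j\<close> up to the total order \<open>m\<close> and collecting equal powers of \<open>x\<close>,
  the Bernoulli recursion cancels the main terms: the defect consists of the Taylor remainders only.\<close>

lemma power_defect_eq_remainders:
  assumes "m \<ge> 1"
  shows "power_defect m w x = (\<Sum>j\<le>m. of_rat (bernoulli_number j) * (w gchoose j) *
     (of_real (x + 1) powr (w - of_nat j) -
       (\<Sum>l\<le>m - j. ((w - of_nat j) gchoose l) * of_real x powr (w - of_nat j - of_nat l))))"
proof -
  let ?B = "\<lambda>j. of_rat (bernoulli_number j) :: complex"
  let ?h = "\<lambda>r. (w gchoose r) * of_real x powr (w - of_nat r)"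
  have rec: "(\<Sum>j\<le>r. of_nat (r choose j) * ?B j) = ?B r + (if r = 1 then 1 else 0)" for r
  proof -
    have "(\<Sum>j<r. of_nat (r choose j) * bernoulli_number j) + bernoulli_number r =
        bernoulli_number r + (if r = 1 then 1 else 0)"
      by (simp add: bernoulli_recursion)
    then have "(\<Sum>j\<le>r. of_nat (r choose j) * bernoulli_number j) =
        bernoulli_number r + (if r = 1 then 1 else 0)"
      by (simp add: lessThan_Suc_atMost [symmetric])
    from arg_cong[OF this, of "of_rat :: rat \<Rightarrow> complex"] show ?thesis
      by (simp add: of_rat_sum of_rat_mult of_rat_add split: if_splits)
  qed
  have "(\<Sum>j\<le>m. ?B j * (w gchoose j) *
       (\<Sum>l\<le>m - j. ((w - of_nat j) gchoose l) * of_real x powr (w - of_nat j - of_nat l)))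
     = (\<Sum>j\<le>m. \<Sum>l\<le>m - j. of_nat ((j + l) choose j) * ?B j * ?h (j + l))"
  proof (intro sum.cong refl)
    fix j assume "j \<in> {..m}"
    have "?B j * (w gchoose j) * (((w - of_nat j) gchoose l) * of_real x powr (w - of_nat j - of_nat l))
        = of_nat ((j + l) choose j) * ?B j * ?h (j + l)" for l
    proof -
      have "?B j * (w gchoose j) * (((w - of_nat j) gchoose l) * of_real x powr (w - of_nat j - of_nat l))
        = ?B j * ((w gchoose j) * ((w - of_nat j) gchoose l)) * of_real x powr (w - of_nat (j + l))"
        by (simp add: algebra_simps)
      then show ?thesis unfolding gbinomial_product by (simp add: algebra_simps)
    qed
    then show "?B j * (w gchoose j) *
       (\<Sum>l\<le>m - j. ((w - of_nat j) gchoose l) * of_real x powr (w - of_nat j - of_nat l))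
       = (\<Sum>l\<le>m - j. of_nat ((j + l) choose j) * ?B j * ?h (j + l))"
      by (simp only: sum_distrib_left)
  qed
  also have "\<dots> = (\<Sum>(j, l)\<in>(SIGMA j:{..m}. {..m - j}). of_nat ((j + l) choose j) * ?B j * ?h (j + l))"
    by (simp add: sum.Sigma)
  \<comment> \<open>Collect the terms of equal total degree \<open>r = j + l\<close>.\<close>
  also have "\<dots> = (\<Sum>(r, j)\<in>(SIGMA r:{..m}. {..r}). of_nat (r choose j) * ?B j * ?h r)"
    by (rule sum.reindex_bij_witness[of _ "\<lambda>(r, j). (j, r - j)" "\<lambda>(j, l). (j + l, j)"]) auto
  also have "\<dots> = (\<Sum>r\<le>m. (\<Sum>j\<le>r. of_nat (r choose j) * ?B j) * ?h r)"
    by (simp add: sum.Sigma [symmetric] sum_distrib_right)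
  also have "\<dots> = (\<Sum>r\<le>m. ?B r * ?h r) + (\<Sum>r\<le>m. (if r = 1 then ?h r else 0))"
    unfolding rec by (simp add: distrib_right sum.distrib if_distrib[of "\<lambda>a. a * _"] cong: if_cong)
  also have "(\<Sum>r\<le>m. (if r = 1 then ?h r else 0)) = w * of_real x powr (w - 1)"
    using assms by (subst sum.delta) auto
  also have "(\<Sum>r\<le>m. ?B r * ?h r) = bernoulli_power m w x"
    by (simp add: bernoulli_power_def mult.assoc)
  finally show ?thesis
    unfolding power_defect_def
    by (simp add: right_diff_distrib sum_subtractf bernoulli_power_def)
qed

text \<open>The bound is \<open>\<bar>binomial(-R, l)\<bar>\<close>, which makes the binomial series at \<open>-1/2\<close> with exponent \<open>-R\<close> a
  majorant that is uniform in \<open>w\<close>.\<close>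

lemma norm_gbinomial_le:
  fixes w :: complex
  assumes "norm w \<le> R"
  shows "norm (w gchoose l) \<le> pochhammer R l / fact l"
proof -
  have "norm (\<Prod>i = 0..<l. w - of_nat i) \<le> (\<Prod>i = 0..<l. R + of_nat i)"
    unfolding prod_norm [symmetric]
  proof (intro prod_mono conjI norm_ge_zero)
    fix i
    have "norm (w - of_nat i) \<le> norm w + norm (of_nat i :: complex)"
      by (rule norm_triangle_ineq4)
    with assms show "norm (w - of_nat i) \<le> R + of_nat i" by simp
  qed
  then show ?thesis
    by (simp add: gbinomial_prod_rev norm_divide pochhammer_prod divide_right_mono)
qed

lemma summable_pochhammer_half:
  "summable (\<lambda>l. pochhammer (R::real) l / fact l * (1 / 2) ^ l)"
proof -
  have "(\<lambda>l. ((-R) gchoose l) * (-1/2) ^ l) sums (1 + (-1/2)) powr (-R)"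
    by (rule gen_binomial_real) simp
  moreover have "((-R) gchoose l) * (-1/2) ^ l = pochhammer R l / fact l * (1 / 2) ^ l" for l
    by (simp add: gbinomial_pochhammer power_divide minus_one_power_iff)
  ultimately show ?thesis by (simp add: sums_iff)
qed

text \<open>The constant depends on \<open>R\<close> and \<open>J\<close> only; this uniformity in \<open>w\<close> yields holomorphy of the series
  of defects below.\<close>

lemma binomial_remainder_bound:
  obtains C where "\<And>w x. norm (w :: complex) \<le> R \<Longrightarrow> x \<ge> 2 \<Longrightarrow>
    norm (of_real (x + 1) powr w - (\<Sum>l<J. (w gchoose l) * of_real x powr (w - of_nat l)))
      \<le> C * x powr (Re w - real J)"
proof -
  let ?c = "\<lambda>l. pochhammer R l / fact l"
  have sum_c: "summable (\<lambda>i. ?c (i + J) * (1 / 2) ^ i)"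
  proof -
    have "summable (\<lambda>i. ?c (i + J) * (1 / 2) ^ (i + J) * 2 ^ J)"
      by (intro summable_mult2 summable_ignore_initial_segment summable_pochhammer_half)
    then show ?thesis by (simp add: power_add power_divide mult.assoc)
  qed
  show ?thesis
  proof (rule that)
    fix w :: complex and x :: real
    assume w: "norm w \<le> R" and x: "x \<ge> 2"
    let ?t = "\<lambda>l. (w gchoose l) * of_real x powr (w - of_nat l)"
    have sums: "?t sums of_real (x + 1) powr w"
      using gen_binomial_complex''[of 1 x w] x by simp
    have tail: "(\<lambda>i. ?t (i + J)) sums (of_real (x + 1) powr w - (\<Sum>l<J. ?t l))"
      by (rule sums_split_initial_segment[OF sums])
    have le: "norm (?t (i + J)) \<le> x powr (Re w - real J) * (?c (i + J) * (1 / 2) ^ i)" for i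
    proof -
      have "norm (complex_of_real x powr (w - of_nat (i + J))) = x powr (Re w - real J) * (1 / x) ^ i"
      proof -
        have "norm (complex_of_real x powr (w - of_nat (i + J))) = x powr ((Re w - real J) - real i)"
          using x by (simp add: norm_powr_real_powr algebra_simps)
        also have "\<dots> = x powr (Re w - real J) * (1 / x) ^ i"
          using x by (subst powr_diff) (simp add: powr_realpow power_divide)
        finally show ?thesis .
      qed
      also have "\<dots> \<le> x powr (Re w - real J) * (1 / 2) ^ i"
        using x by (intro mult_left_mono power_mono) (auto simp: field_simps)
      finally have "norm (?t (i + J)) \<le> ?c (i + J) * (x powr (Re w - real J) * (1 / 2) ^ i)"
        unfolding norm_mult using norm_gbinomial_le[OF w] by (intro mult_mono) (auto intro: order_trans[OF norm_ge_zero])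
      then show ?thesis by (simp add: algebra_simps)
    qed
    have "norm (\<Sum>i. ?t (i + J)) \<le> (\<Sum>i. x powr (Re w - real J) * (?c (i + J) * (1 / 2) ^ i))"
      by (intro norm_suminf_le le summable_mult sum_c)
    also have "\<dots> = (\<Sum>i. ?c (i + J) * (1 / 2) ^ i) * x powr (Re w - real J)"
      by (subst suminf_mult[OF sum_c]) (simp add: mult.commute)
    finally show "norm (of_real (x + 1) powr w - (\<Sum>l<J. ?t l)) \<le>
        (\<Sum>i. ?c (i + J) * (1 / 2) ^ i) * x powr (Re w - real J)"
      using tail by (simp add: sums_iff)
  qed
qed

lemma power_defect_bound:
  assumes "m \<ge> 1"
  obtains C where "C \<ge> 0" "\<And>w x. norm w \<le> R \<Longrightarrow> x \<ge> 2 \<Longrightarrow>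
    norm (power_defect m w x) \<le> C * x powr (Re w - real m - 1)"
proof -
  have "\<exists>C. \<forall>w x. norm (w :: complex) \<le> R + real m \<longrightarrow> x \<ge> 2 \<longrightarrow>
    norm (of_real (x + 1) powr w - (\<Sum>l<Suc (m - j). (w gchoose l) * of_real x powr (w - of_nat l)))
      \<le> C * x powr (Re w - real (Suc (m - j)))" for j
    using binomial_remainder_bound[of "R + real m" "Suc (m - j)"] by metis
  then obtain C where C: "\<And>j w x. norm (w :: complex) \<le> R + real m \<Longrightarrow> x \<ge> 2 \<Longrightarrow>
    norm (of_real (x + 1) powr w - (\<Sum>l<Suc (m - j). (w gchoose l) * of_real x powr (w - of_nat l)))
      \<le> C j * x powr (Re w - real (Suc (m - j)))"
    by metis
  define b where "b j = norm (of_rat (bernoulli_number j) :: complex) * \<bar>pochhammer R j / fact j\<bar>" for j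
  show ?thesis
  proof (rule that)
    show "(\<Sum>j\<le>m. b j * \<bar>C j\<bar>) \<ge> 0"
      by (intro sum_nonneg) (auto simp: b_def)
    fix w :: complex and x :: real
    assume w: "norm w \<le> R" and x: "x \<ge> 2"
    have "norm (power_defect m w x) \<le> (\<Sum>j\<le>m. b j * (\<bar>C j\<bar> * x powr (Re w - real m - 1)))"
      unfolding power_defect_eq_remainders[OF assms]
    proof (rule sum_norm_le)
      fix j assume j: "j \<in> {..m}"
      have "norm (w - of_nat j) \<le> norm w + norm (of_nat j :: complex)"
        by (rule norm_triangle_ineq4)
      with w j have wj: "norm (w - of_nat j) \<le> R + real m" by simp
      have e: "Re (w - of_nat j) - real (Suc (m - j)) = Re w - real m - 1"
        using j by (simp add: of_nat_diff)
      with C[OF wj x, of j] have "norm (of_real (x + 1) powr (w - of_nat j) -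
         (\<Sum>l\<le>m - j. ((w - of_nat j) gchoose l) * of_real x powr (w - of_nat j - of_nat l)))
         \<le> C j * x powr (Re w - real m - 1)"
        by (simp only: lessThan_Suc_atMost e)
      also have "\<dots> \<le> \<bar>C j\<bar> * x powr (Re w - real m - 1)"
        by (intro mult_right_mono) auto
      finally show "norm (of_rat (bernoulli_number j) * (w gchoose j) *
         (of_real (x + 1) powr (w - of_nat j) -
         (\<Sum>l\<le>m - j. ((w - of_nat j) gchoose l) * of_real x powr (w - of_nat j - of_nat l))))
         \<le> b j * (\<bar>C j\<bar> * x powr (Re w - real m - 1))"
        unfolding norm_mult b_def
        by (intro mult_mono order.refl order.trans[OF norm_gbinomial_le[OF w] abs_ge_self]) auto
    qed
    then show "norm (power_defect m w x) \<le> (\<Sum>j\<le>m. b j * \<bar>C j\<bar>) * x powr (Re w - real m - 1)"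
      by (simp add: sum_distrib_right mult.assoc)
  qed
qed

text \<open>With \<open>w = 1 - s\<close> this is \<open>(s - 1) \<zeta>(s)\<close> on the half plane \<open>Re s > 1 - m\<close>.\<close>

definition zeta_numerator :: "nat \<Rightarrow> complex \<Rightarrow> complex" where
  "zeta_numerator m w = bernoulli_power m w 1 + (\<Sum>n. power_defect m w (real (Suc n)))"

text \<open>The index \<open>n = 0\<close>, that is \<open>x = 1\<close>, is left out because the binomial expansion is only used for
  \<open>x \<ge> 2\<close>.\<close>

lemma power_defect_uniform_bound:
  assumes "m \<ge> 1" and d: "d > 0"
  obtains M where "summable M" "\<And>n w. norm w \<le> R \<Longrightarrow> Re w \<le> real m - d \<Longrightarrow> n \<ge> 1 \<Longrightarrow>
    norm (power_defect m w (real (Suc n))) \<le> M n"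
proof -
  obtain C where C: "C \<ge> 0" "\<And>w x. norm w \<le> R \<Longrightarrow> x \<ge> 2 \<Longrightarrow>
    norm (power_defect m w x) \<le> C * x powr (Re w - real m - 1)"
    using power_defect_bound[OF assms(1)] by metis
  show ?thesis
  proof (rule that)
    have "summable (\<lambda>n. real n powr (- d - 1))"
      using d by (simp add: summable_real_powr_iff)
    then show "summable (\<lambda>n. C * real (Suc n) powr (- d - 1))"
      by (intro summable_mult) (subst summable_Suc_iff)
    fix n :: nat and w :: complex
    assume w: "norm w \<le> R" "Re w \<le> real m - d" and n: "n \<ge> 1"
    have "norm (power_defect m w (real (Suc n))) \<le> C * real (Suc n) powr (Re w - real m - 1)"
      using n by (intro C w) simp
    also have "\<dots> \<le> C * real (Suc n) powr (- d - 1)"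
      using w C by (intro mult_left_mono powr_mono) auto
    finally show "norm (power_defect m w (real (Suc n))) \<le> C * real (Suc n) powr (- d - 1)" .
  qed
qed

lemma summable_power_defect:
  assumes "m \<ge> 1" "Re w < real m"
  shows "summable (\<lambda>n. power_defect m w (real (Suc n)))"
proof -
  have "real m - Re w > 0" using assms by simp
  from power_defect_uniform_bound[OF assms(1) this]
  obtain M where M: "summable M" "\<And>n v. norm v \<le> norm w \<Longrightarrow> Re v \<le> real m - (real m - Re w) \<Longrightarrow> n \<ge> 1 \<Longrightarrow>
    norm (power_defect m v (real (Suc n))) \<le> M n"
    by metis
  show ?thesis
    by (rule summable_comparison_test'[OF M(1), of 1]) (use M(2) in auto)
qed

lemma holomorphic_power_defect:
  assumes "x > 0"
  shows "(\<lambda>w. power_defect m w x) holomorphic_on A" "(\<lambda>w. bernoulli_power m w x) holomorphic_on A"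
  using assms unfolding power_defect_def bernoulli_power_def gbinomial_prod_rev
  by (auto intro!: holomorphic_intros)

lemma holomorphic_zeta_numerator:
  assumes m: "m \<ge> 1"
  shows "zeta_numerator m holomorphic_on {w. Re w < real m}"
proof -
  let ?S = "{w. Re w < real m}"
  have S: "open ?S" by (rule open_halfspace_Re_lt)
  have "(\<lambda>w. \<Sum>n. power_defect m w (real (Suc n))) holomorphic_on ?S"
  proof (rule holomorphic_uniform_sequence[OF S])
    show "(\<lambda>w. \<Sum>i<n. power_defect m w (real (Suc i))) holomorphic_on ?S" for n
      by (intro holomorphic_intros holomorphic_power_defect) simp
    fix v assume v: "v \<in> ?S"
    define d where "d = (real m - Re v) / 2"
    have d: "d > 0" using v by (simp add: d_def)
    have ball: "Re w \<le> real m - d" "norm w \<le> norm v + d" if "w \<in> cball v d" for w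
    proof -
      have "norm (w - v) \<le> d" using that by (simp add: dist_norm norm_minus_commute)
      moreover have "Re (w - v) \<le> norm (w - v)" by (rule complex_Re_le_cmod)
      ultimately show "Re w \<le> real m - d" by (simp add: d_def field_simps)
      show "norm w \<le> norm v + d"
        using \<open>norm (w - v) \<le> d\<close> norm_triangle_sub[of w v] by linarith
    qed
    obtain M where M: "summable M" "\<And>n w. norm w \<le> norm v + d \<Longrightarrow> Re w \<le> real m - d \<Longrightarrow> n \<ge> 1 \<Longrightarrow>
      norm (power_defect m w (real (Suc n))) \<le> M n"
      using power_defect_uniform_bound[OF m d] by metis
    have "uniform_limit (cball v d) (\<lambda>n w. \<Sum>i<n. power_defect m w (real (Suc i)))
        (\<lambda>w. \<Sum>n. power_defect m w (real (Suc n))) sequentially"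
    proof (rule Weierstrass_m_test_ev[OF _ M(1)])
      show "\<forall>\<^sub>F n in sequentially. \<forall>w\<in>cball v d. norm (power_defect m w (real (Suc n))) \<le> M n"
        using eventually_ge_at_top[of 1]
        by eventually_elim (use M(2) ball in blast)
    qed
    moreover have "cball v d \<subseteq> ?S"
      using ball(1) d by fastforce
    ultimately show "\<exists>d>0. cball v d \<subseteq> ?S \<and>
        uniform_limit (cball v d) (\<lambda>n w. \<Sum>i<n. power_defect m w (real (Suc i)))
        (\<lambda>w. \<Sum>n. power_defect m w (real (Suc n))) sequentially"
      using d by blast
  qed
  then show ?thesis
    unfolding zeta_numerator_def by (intro holomorphic_on_add holomorphic_power_defect) auto
qed

text \<open>For \<open>Re w < 0\<close> the differences of \<open>bernoulli_power\<close> telescope to \<open>- bernoulli_power m w 1\<close>, so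
  only the Dirichlet series remains.\<close>

lemma zeta_series_sums:
  assumes m: "m \<ge> 1" and w: "Re w < 0"
  shows "(\<lambda>n. of_nat (Suc n) powr (w - 1)) sums (- zeta_numerator m w / w)"
proof -
  have lim: "(\<lambda>n. bernoulli_power m w (real (Suc n))) \<longlonglongrightarrow> 0"
  proof -
    have "(\<lambda>n. complex_of_real (real (Suc n)) powr (w - of_nat j)) \<longlonglongrightarrow> 0" for j
    proof (rule tendsto_norm_zero_cancel)
      have "(\<lambda>n. real (Suc n) powr (Re w - real j)) \<longlonglongrightarrow> 0"
        using w by (intro tendsto_neg_powr filterlim_compose[OF filterlim_real_sequentially filterlim_Suc]) auto
      then show "(\<lambda>n. norm (complex_of_real (real (Suc n)) powr (w - of_nat j))) \<longlonglongrightarrow> 0"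
        by (simp add: norm_powr_real_powr del: of_nat_Suc)
    qed
    then have "(\<lambda>n. bernoulli_power m w (real (Suc n))) \<longlonglongrightarrow>
        (\<Sum>j\<le>m. of_rat (bernoulli_number j) * (w gchoose j) * 0)"
      unfolding bernoulli_power_def by (intro tendsto_intros)
    then show ?thesis by simp
  qed
  have "(\<lambda>n. bernoulli_power m w (real (Suc (Suc n))) - bernoulli_power m w (real (Suc n)))
      sums (0 - bernoulli_power m w (real (Suc 0)))"
    by (rule telescope_sums[OF lim])
  moreover have "(\<lambda>n. power_defect m w (real (Suc n))) sums (\<Sum>n. power_defect m w (real (Suc n)))"
    using m w by (intro summable_sums summable_power_defect) auto
  ultimately have "(\<lambda>n. bernoulli_power m w (real (Suc (Suc n))) - bernoulli_power m w (real (Suc n)) -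
      power_defect m w (real (Suc n))) sums
      (0 - bernoulli_power m w (real (Suc 0)) - (\<Sum>n. power_defect m w (real (Suc n))))"
    by (rule sums_diff)
  then have "(\<lambda>n. w * of_nat (Suc n) powr (w - 1)) sums (- zeta_numerator m w)"
    by (simp add: power_defect_def zeta_numerator_def add.commute algebra_simps)
  from sums_divide[OF this, of w] have
    "(\<lambda>n. w * of_nat (Suc n) powr (w - 1) / w) sums (- zeta_numerator m w / w)" .
  moreover have "w \<noteq> 0" using w by auto
  ultimately show ?thesis by simp
qed

text \<open>At a natural number the binomial expansions are finite and exact, so all defects vanish, and the
  Bernoulli recursion evaluates the remaining value \<open>B\<^sub>N(1)\<close>.\<close>

lemma zeta_numerator_at_nat:
  assumes m: "N < m" and N: "N \<ge> 2"
  shows "zeta_numerator m (of_nat N) = of_rat (bernoulli_number N)"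
proof -
  have m1: "m \<ge> 1" using m N by simp
  have pow: "of_real x powr (of_nat N - of_nat j :: complex) = of_real x ^ (N - j)" if "x > 0" "j \<le> N" for x j
    using that by (simp add: powr_nat' flip: of_nat_diff)
  have zero: "power_defect m (of_nat N) x = 0" if x: "x > 0" for x
    unfolding power_defect_eq_remainders[OF m1]
  proof (intro sum.neutral ballI)
    fix j assume j: "j \<in> {..m}"
    show "of_rat (bernoulli_number j) * ((of_nat N :: complex) gchoose j) *
      (of_real (x + 1) powr (of_nat N - of_nat j) -
       (\<Sum>l\<le>m - j. ((of_nat N - of_nat j) gchoose l) * of_real x powr (of_nat N - of_nat j - of_nat l))) = 0"
    proof (cases "j \<le> N")
      case False
      then show ?thesis by (simp add: binomial_gbinomial [symmetric])
    next
      case True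
      have "(\<Sum>l\<le>m - j. ((of_nat N - of_nat j) gchoose l) * complex_of_real x powr (of_nat N - of_nat j - of_nat l))
        = (\<Sum>l\<le>N - j. of_nat ((N - j) choose l) * complex_of_real x ^ (N - j - l))"
      proof (rule sum.mono_neutral_cong_right)
        show "\<forall>l\<in>{..m - j} - {..N - j}. ((of_nat N - of_nat j) gchoose l) *
           complex_of_real x powr (of_nat N - of_nat j - of_nat l) = 0"
          using True by (auto simp: binomial_gbinomial [symmetric] simp flip: of_nat_diff)
        show "((of_nat N - of_nat j) gchoose l) * complex_of_real x powr (of_nat N - of_nat j - of_nat l) =
            of_nat ((N - j) choose l) * complex_of_real x ^ (N - j - l)" if "l \<in> {..N - j}" for l
          using True that pow[OF x, of "j + l"]
          by (simp add: binomial_gbinomial of_nat_diff algebra_simps)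
      qed (use m in auto)
      also have "\<dots> = (complex_of_real x + 1) ^ (N - j)"
        using binomial_ring[of 1 "complex_of_real x" "N - j"] by (simp add: add.commute)
      finally show ?thesis
        using pow[of "x + 1" j] x True by simp
    qed
  qed
  have "zeta_numerator m (of_nat N) = (\<Sum>j\<le>m. of_rat (bernoulli_number j) * of_nat (N choose j))"
    unfolding zeta_numerator_def bernoulli_power_def by (simp add: zero binomial_gbinomial)
  also have "\<dots> = (\<Sum>j\<le>N. of_rat (bernoulli_number j) * of_nat (N choose j))"
    using m by (intro sum.mono_neutral_right) auto
  also have "\<dots> = of_rat ((\<Sum>j<N. of_nat (N choose j) * bernoulli_number j) + bernoulli_number N)"
    by (simp add: of_rat_sum of_rat_mult of_rat_add mult.commute lessThan_Suc_atMost [symmetric])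
  also have "\<dots> = of_rat (bernoulli_number N)"
    using N by (simp add: bernoulli_recursion)
  finally show ?thesis .
qed

lemma zeta_numerator_unique:
  assumes m: "m \<ge> 1" "m' \<ge> 1" and w: "Re w < real m" "Re w < real m'"
  shows "zeta_numerator m w = zeta_numerator m' w"
proof -
  let ?S = "{w. Re w < min (real m) (real m')}"
  show ?thesis
  proof (rule analytic_continuation_open[where s = "{w. Re w < 0}" and s' = ?S and f = "zeta_numerator m"])
    show "zeta_numerator m holomorphic_on ?S" "zeta_numerator m' holomorphic_on ?S"
      by (auto intro: holomorphic_on_subset[OF holomorphic_zeta_numerator] m)
    show "zeta_numerator m v = zeta_numerator m' v" if "v \<in> {w. Re w < 0}" for v
    proof -
      have "- zeta_numerator m v / v = - zeta_numerator m' v / v"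
        using that m by (intro sums_unique2[OF zeta_series_sums zeta_series_sums]) auto
      with that show ?thesis by auto
    qed
    have "-1 \<in> {w. Re w < 0}" by simp
    then show "{w. Re w < 0} \<noteq> {}" by blast
    show "open {w. Re w < 0}" "open ?S"
      by (rule open_halfspace_Re_lt)+
    show "connected ?S"
      by (rule convex_connected[OF convex_halfspace_Re_lt])
  qed (use w in auto)
qed

definition is_zeta :: "(complex \<Rightarrow> complex) \<Rightarrow> bool" where
  "is_zeta f \<longleftrightarrow> f holomorphic_on - {1} \<and>
     (\<forall>s. Re s > 1 \<longrightarrow> (\<lambda>n. of_nat (Suc n) powr (- s)) sums f s)"

text \<open>The continuations to the half planes \<open>Re s > 1 - m\<close> agree where they overlap.  The index \<open>\<mu> s\<close>
  is chosen large enough to serve on the whole unit ball around \<open>s\<close>, so that near \<open>s\<close> the glued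
  function coincides with a single holomorphic one.\<close>

lemma zeta_exists: "\<exists>f. is_zeta f"
proof -
  define \<mu> where "\<mu> s = nat \<lceil>\<bar>Re s\<bar>\<rceil> + 3" for s :: complex
  define f where "f s = zeta_numerator (\<mu> s) (1 - s) / (s - 1)" for s
  have \<mu>: "\<mu> s \<ge> 1" "Re (1 - s) < real (\<mu> s)" for s
    unfolding \<mu>_def by (auto simp: of_nat_nat) linarith
  have "f field_differentiable at s" if s: "s \<noteq> 1" for s
  proof -
    let ?U = "ball s 1 - {1}"
    have bd: "Re (1 - z) < real (\<mu> s)" if "z \<in> ?U" for z
    proof -
      have "norm (s - z) < 1" using that by (simp add: dist_norm)
      moreover have "Re (s - z) \<le> norm (s - z)" by (rule complex_Re_le_cmod)
      ultimately have "Re s - Re z < 1" by simp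
      then show ?thesis unfolding \<mu>_def by simp linarith
    qed
    have "zeta_numerator (\<mu> s) holomorphic_on {w. Re w < real (\<mu> s)}"
      by (rule holomorphic_zeta_numerator[OF \<mu>(1)])
    then have "(zeta_numerator (\<mu> s) \<circ> (\<lambda>z. 1 - z)) holomorphic_on ?U"
      using bd by (intro holomorphic_on_compose_gen[where t = "{w. Re w < real (\<mu> s)}"]) (auto intro!: holomorphic_intros)
    then have "(\<lambda>z. zeta_numerator (\<mu> s) (1 - z) / (z - 1)) holomorphic_on ?U"
      by (intro holomorphic_intros) (auto simp: o_def)
    moreover have "zeta_numerator (\<mu> s) (1 - z) / (z - 1) = f z" if "z \<in> ?U" for z
      unfolding f_def by (subst zeta_numerator_unique[OF \<mu>(1) \<mu>(1)[of z] bd[OF that] \<mu>(2)]) simp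
    ultimately have "f holomorphic_on ?U"
      by (rule holomorphic_transform)
    then show ?thesis
      by (rule holomorphic_on_imp_differentiable_at) (use s in auto)
  qed
  then have "f holomorphic_on - {1}"
    by (auto simp: holomorphic_on_def field_differentiable_at_within)
  moreover have "(\<lambda>n. of_nat (Suc n) powr (- s)) sums f s" if "Re s > 1" for s
  proof -
    have "s \<noteq> 1" using that by auto
    then have "- zeta_numerator (\<mu> s) (1 - s) / (1 - s) = f s"
      unfolding f_def by (simp add: divide_simps) (simp add: algebra_simps)
    moreover have "(\<lambda>n. of_nat (Suc n) powr ((1 - s) - 1)) sums (- zeta_numerator (\<mu> s) (1 - s) / (1 - s))"
      using that by (intro zeta_series_sums \<mu>) simp
    ultimately show ?thesis by simp
  qed
  ultimately show ?thesis
    unfolding is_zeta_def by blast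
qed

text \<open>By the identity theorem every continuation agrees with the explicit one on a punctured half plane
  containing \<open>1 - N\<close>.\<close>

lemma zeta_at_negative:
  assumes f: "is_zeta f" and N: "N \<ge> 2"
  shows "f (1 - of_nat N) = - of_rat (bernoulli_number N) / of_nat N"
proof -
  let ?m = "Suc N"
  let ?H = "{s. Re s > 1 - real ?m}"
  let ?U = "?H - {1}"
  have H: "open ?H" "connected ?H"
    by (auto intro: open_halfspace_Re_gt convex_connected convex_halfspace_Re_gt)
  have hol: "(\<lambda>s. zeta_numerator ?m (1 - s)) holomorphic_on ?U"
  proof -
    have "(zeta_numerator ?m \<circ> (\<lambda>s. 1 - s)) holomorphic_on ?U"
      by (intro holomorphic_on_compose_gen[OF _ holomorphic_zeta_numerator]) (auto intro!: holomorphic_intros)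
    then show ?thesis by (simp add: o_def)
  qed
  have "f (1 - of_nat N) * ((1 - of_nat N) - 1) = zeta_numerator ?m (1 - (1 - of_nat N))"
  proof (rule analytic_continuation_open[where s = "{s. Re s > 1}" and s' = ?U
        and f = "\<lambda>s. f s * (s - 1)" and g = "\<lambda>s. zeta_numerator ?m (1 - s)"])
    show "open ?U" using H by (intro open_Diff) auto
    show "connected ?U" using H by (intro connected_open_delete) auto
    show "(\<lambda>s. f s * (s - 1)) holomorphic_on ?U"
      using f by (auto simp: is_zeta_def intro!: holomorphic_intros elim: holomorphic_on_subset)
    show "f s * (s - 1) = zeta_numerator ?m (1 - s)" if "s \<in> {s. Re s > 1}" for s
    proof -
      have "(\<lambda>n. of_nat (Suc n) powr ((1 - s) - 1)) sums (- zeta_numerator ?m (1 - s) / (1 - s))"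
        using that by (intro zeta_series_sums) auto
      moreover have "(\<lambda>n. of_nat (Suc n) powr (- s)) sums f s"
        using f that by (auto simp: is_zeta_def)
      ultimately have "f s = - zeta_numerator ?m (1 - s) / (1 - s)"
        by (simp add: sums_unique2)
      moreover have "s \<noteq> 1" using that by auto
      ultimately show ?thesis by (simp add: divide_simps) (simp add: algebra_simps)
    qed
    have "2 \<in> {s. Re s > 1}" by simp
    then show "{s. Re s > 1} \<noteq> {}" by blast
    show "1 - of_nat N \<in> ?U" using N by auto
  qed (use hol in \<open>auto intro: open_halfspace_Re_gt\<close>)
  then show ?thesis
    using N by (simp add: zeta_numerator_at_nat nonzero_eq_divide_eq minus_equation_iff mult.commute)
qed

lemma riemann_zeta_at_negative:
  assumes "N \<ge> 2"
  shows "riemann_zeta (1 - of_nat N) = - of_rat (bernoulli_number N) / of_nat N"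
proof -
  have "riemann_zeta = (SOME f. is_zeta f)"
    by (simp add: riemann_zeta_def is_zeta_def)
  then have "is_zeta riemann_zeta"
    using someI_ex[OF zeta_exists] by simp
  from zeta_at_negative[OF this assms] show ?thesis .
qed

section \<open>Summation over the integral points of a quadric threefold\<close>

lemma summable_on_Un_real:
  fixes f :: "'a \<Rightarrow> real"
  assumes "f summable_on A" "f summable_on B"
  shows "f summable_on (A \<union> B)"
proof -
  have "f summable_on (B - A)"
    using assms(2) by (rule summable_on_subset_banach) auto
  then have "f summable_on (A \<union> (B - A))"
    using assms(1) by (intro summable_on_Un_disjoint) auto
  then show ?thesis by simp
qed

lemma summable_on_product_nonneg:
  fixes f :: "'a \<Rightarrow> real" and g :: "'b \<Rightarrow> real"
  assumes "f summable_on UNIV" "g summable_on UNIV" "\<And>x. f x \<ge> 0" "\<And>y. g y \<ge> 0"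
  shows "(\<lambda>(x, y). f x * g y) summable_on UNIV"
proof -
  have "(\<lambda>(x, y). f x * g y) summable_on (SIGMA x:UNIV. UNIV)"
  proof (rule summable_on_SigmaI)
    show "((\<lambda>y. case (x, y) of (x, y) \<Rightarrow> f x * g y) has_sum f x * infsum g UNIV) UNIV" for x
      using assms(2) by (simp add: has_sum_cmult_right)
    show "(\<lambda>x. f x * infsum g UNIV) summable_on UNIV"
      using assms(1) by (rule summable_on_cmult_left)
  qed (use assms in auto)
  then show ?thesis by simp
qed

text \<open>A point of the quadric is described below by five integers whose sizes multiply to at most a
  constant times the cube of the size \<open>\<bar>a\<bar>\<close> of the point.  The exponent \<open>- 4 / 3\<close> turns this into
  \<open>\<bar>a\<bar>\<^sup>-\<^sup>4\<close> and is still smaller than \<open>- 1\<close>.\<close>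

definition decay :: "int \<Rightarrow> real" where
  "decay n = (1 + \<bar>real_of_int n\<bar>) powr (- 4 / 3)"

lemma decay_summable: "decay summable_on UNIV"
proof -
  have "summable (\<lambda>n. real n powr (- 4 / 3))"
    by (simp add: summable_real_powr_iff)
  then have "summable (\<lambda>n. real (Suc n) powr (- 4 / 3))"
    by (subst summable_Suc_iff)
  then have nat: "(\<lambda>n. real (Suc n) powr (- 4 / 3)) summable_on UNIV"
    by (subst summable_on_UNIV_nonneg_real_iff) auto
  have "decay summable_on range int"
    by (subst summable_on_reindex) (use nat in \<open>auto simp: decay_def o_def\<close>)
  moreover have "decay summable_on range (\<lambda>n. - int n)"
    by (subst summable_on_reindex) (use nat in \<open>auto simp: decay_def o_def inj_on_def\<close>)
  ultimately have "decay summable_on (range int \<union> range (\<lambda>n. - int n))"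
    by (rule summable_on_Un_real)
  also have "range int \<union> range (\<lambda>n. - int n) = UNIV"
    by (auto simp: image_iff) (metis int_cases2)
  finally show ?thesis .
qed

type_synonym quintuple = "int \<times> int \<times> int \<times> int \<times> int"

definition decay5 :: "quintuple \<Rightarrow> real" where
  "decay5 = (\<lambda>(g, a, c, e, t). decay g * (decay a * (decay c * (decay e * decay t))))"

lemma decay5_summable: "decay5 summable_on UNIV"
proof -
  have nonneg: "decay n \<ge> 0" for n by (simp add: decay_def)
  have 2: "(\<lambda>(e, t). decay e * decay t) summable_on UNIV"
    by (intro summable_on_product_nonneg decay_summable nonneg)
  have 3: "(\<lambda>(c, x). decay c * (case x of (e, t) \<Rightarrow> decay e * decay t)) summable_on UNIV"
    by (intro summable_on_product_nonneg decay_summable 2) (auto simp: nonneg)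
  have 4: "(\<lambda>(a, x). decay a * (case x of (c, e, t) \<Rightarrow> decay c * (decay e * decay t))) summable_on UNIV"
    using 3 by (intro summable_on_product_nonneg decay_summable) (auto simp: nonneg case_prod_unfold)
  have "(\<lambda>(g, x). decay g * (case x of (a, c, e, t) \<Rightarrow> decay a * (decay c * (decay e * decay t)))) summable_on UNIV"
    using 4 by (intro summable_on_product_nonneg decay_summable) (auto simp: nonneg case_prod_unfold)
  then show ?thesis by (simp add: decay5_def case_prod_unfold)
qed

definition quadric :: "quintuple set" where
  "quadric = {(a, b, c, d, e). a * b + c * d + e\<^sup>2 = 0} - {(0, 0, 0, 0, 0)}"

definition height :: "quintuple \<Rightarrow> int" where
  "height = (\<lambda>(a, b, c, d, e). a\<^sup>2 + b\<^sup>2 + c\<^sup>2 + d\<^sup>2 + e\<^sup>2)"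

text \<open>One of \<open>a, b, c, d\<close> is the largest in absolute value, and the symmetries of the quadric move it to
  the first place.\<close>

definition quadric_chart :: "quintuple set" where
  "quadric_chart = {(a, b, c, d, e) \<in> quadric. \<bar>b\<bar> \<le> \<bar>a\<bar> \<and> \<bar>c\<bar> \<le> \<bar>a\<bar> \<and> \<bar>d\<bar> \<le> \<bar>a\<bar>}"

text \<open>For given \<open>a, c, e\<close> the equation \<open>ab + cd = - e\<^sup>2\<close> determines \<open>d\<close> modulo \<open>a / gcd a c\<close>, and then
  \<open>b\<close>.  So the quotient of \<open>d\<close> by this modulus suffices as last coordinate.\<close>

definition chart_coordinates :: "quintuple \<Rightarrow> quintuple" where
  "chart_coordinates = (\<lambda>(a, b, c, d, e).
     (gcd a c, a div gcd a c, c div gcd a c, e, d div (a div gcd a c)))"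

lemma quadric_chart_nonzero:
  assumes "(a, b, c, d, e) \<in> quadric_chart"
  shows "a \<noteq> 0"
  using assms by (auto simp: quadric_chart_def quadric_def)

lemma inj_chart_coordinates: "inj_on chart_coordinates quadric_chart"
proof (rule inj_onI)
  fix p p'
  assume pp: "p \<in> quadric_chart" "p' \<in> quadric_chart" "chart_coordinates p = chart_coordinates p'"
  obtain a b c d e where p_eq: "p = (a, b, c, d, e)" by (cases p)
  obtain a' b' c' d' e' where p'_eq: "p' = (a', b', c', d', e')" by (cases p')
  have p: "(a, b, c, d, e) \<in> quadric_chart" and p': "(a', b', c', d', e') \<in> quadric_chart"
    and eq: "chart_coordinates (a, b, c, d, e) = chart_coordinates (a', b', c', d', e')"
    using pp by (simp_all add: p_eq p'_eq)
  define g where "g = gcd a c"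
  define \<alpha> where "\<alpha> = a div g"
  define \<gamma> where "\<gamma> = c div g"
  have a: "a \<noteq> 0" by (rule quadric_chart_nonzero[OF p])
  have g: "g > 0" using a by (simp add: g_def)
  have ac: "a = g * \<alpha>" "c = g * \<gamma>" by (auto simp: g_def \<alpha>_def \<gamma>_def)
  have cop: "coprime \<alpha> \<gamma>"
    unfolding \<alpha>_def \<gamma>_def g_def by (rule div_gcd_coprime) (use a in auto)
  from eq have g': "gcd a' c' = g" and "a' div g = \<alpha>" "c' div g = \<gamma>" and e: "e' = e"
    and t: "d div \<alpha> = d' div \<alpha>"
    unfolding chart_coordinates_def g_def \<alpha>_def \<gamma>_def by auto
  then have "a' = g * \<alpha>" "c' = g * \<gamma>"
    by (metis dvd_mult_div_cancel gcd_dvd1, metis dvd_mult_div_cancel gcd_dvd2)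
  with ac have aa: "a' = a" "c' = c" by auto
  have "a * b + c * d + e\<^sup>2 = 0" "a * b' + c * d' + e\<^sup>2 = 0"
    using p p' aa e by (auto simp: quadric_chart_def quadric_def)
  then have "g * (\<gamma> * (d - d')) = g * (\<alpha> * (b' - b))"
    unfolding ac by (simp add: algebra_simps)
  with g have lin: "\<gamma> * (d - d') = \<alpha> * (b' - b)" by simp
  then have "\<alpha> dvd (d - d')"
    using cop by (metis coprime_dvd_mult_right_iff dvd_triv_left)
  then have "d mod \<alpha> = d' mod \<alpha>" by (simp add: mod_eq_dvd_iff)
  with t have d: "d = d'" by (metis mult_div_mod_eq)
  have "\<alpha> \<noteq> 0" using a ac by auto
  with lin d have "b = b'" by simp
  with aa d e show "p = p'" by (simp add: p_eq p'_eq)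
qed

text \<open>The coordinates satisfy \<open>x1 \<bar>x2\<bar> = \<bar>a\<bar>\<close> and \<open>\<bar>x3\<bar> \<le> \<bar>x2\<bar>\<close>; the equation gives \<open>e\<^sup>2 \<le> 2 a\<^sup>2\<close>;
  and division with remainder gives \<open>\<bar>x5 x2\<bar> \<le> \<bar>d\<bar> + \<bar>x2\<bar>\<close>.  In the product the two factors
  \<open>\<bar>x2\<bar>\<close> are absorbed by \<open>x1\<close> and \<open>x5\<close>.\<close>

lemma chart_coordinates_size:
  assumes p: "(a, b, c, d, e) \<in> quadric_chart"
    and x: "chart_coordinates (a, b, c, d, e) = (x1, x2, x3, x4, x5)"
  shows "(1 + \<bar>x1\<bar>) * ((1 + \<bar>x2\<bar>) * ((1 + \<bar>x3\<bar>) * ((1 + \<bar>x4\<bar>) * (1 + \<bar>x5\<bar>)))) \<le> 72 * \<bar>a\<bar> ^ 3"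
proof -
  have a: "a \<noteq> 0" by (rule quadric_chart_nonzero[OF p])
  have le: "\<bar>b\<bar> \<le> \<bar>a\<bar>" "\<bar>c\<bar> \<le> \<bar>a\<bar>" "\<bar>d\<bar> \<le> \<bar>a\<bar>" and rel: "a * b + c * d + e\<^sup>2 = 0"
    using p by (auto simp: quadric_chart_def quadric_def)
  have x1: "x1 = gcd a c" and x2: "x2 = a div x1" and x3: "x3 = c div x1" and x4: "x4 = e"
    and x5: "x5 = d div x2"
    using x by (auto simp: chart_coordinates_def)
  have pos: "x1 > 0" using a by (simp add: x1)
  have ac: "a = x1 * x2" "c = x1 * x3" by (auto simp: x1 x2 x3)
  have x2nz: "x2 \<noteq> 0" using a ac by auto
  have abs_a: "\<bar>a\<bar> = x1 * \<bar>x2\<bar>" using pos by (simp add: ac abs_mult)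
  have "x1 * \<bar>x3\<bar> \<le> x1 * \<bar>x2\<bar>" using le(2) pos by (simp add: ac abs_mult)
  then have x32: "\<bar>x3\<bar> \<le> \<bar>x2\<bar>" using pos by simp
  have e: "1 + \<bar>x4\<bar> \<le> 3 * \<bar>a\<bar>"
  proof -
    have "\<bar>a * b\<bar> \<le> \<bar>a\<bar> * \<bar>a\<bar>" "\<bar>c * d\<bar> \<le> \<bar>a\<bar> * \<bar>a\<bar>"
      unfolding abs_mult by (intro mult_mono le order.refl abs_ge_zero)+
    then have "e\<^sup>2 \<le> \<bar>a\<bar> * \<bar>a\<bar> + \<bar>a\<bar> * \<bar>a\<bar>" using rel by linarith
    also have "\<dots> \<le> (2 * \<bar>a\<bar>)\<^sup>2" by (simp add: power2_eq_square)
    finally have "\<bar>e\<bar> \<le> 2 * \<bar>a\<bar>" by (metis abs_le_square_iff abs_mult abs_abs abs_numeral)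
    with a x4 show ?thesis by linarith
  qed
  have t: "(1 + \<bar>x5\<bar>) * \<bar>x2\<bar> \<le> 3 * \<bar>a\<bar>"
  proof -
    have "x5 * x2 = d - d mod x2" by (simp add: x5 minus_mod_eq_div_mult)
    moreover have "\<bar>d mod x2\<bar> < \<bar>x2\<bar>" using x2nz by (rule abs_mod_less)
    ultimately have "\<bar>x5 * x2\<bar> \<le> \<bar>d\<bar> + \<bar>x2\<bar>" by linarith
    moreover have "\<bar>x2\<bar> \<le> \<bar>a\<bar>" using pos abs_a by (simp add: mult_le_cancel_right1)
    ultimately have "\<bar>x5\<bar> * \<bar>x2\<bar> + \<bar>x2\<bar> \<le> 3 * \<bar>a\<bar>" using le by (simp add: abs_mult)
    then show ?thesis by (simp add: algebra_simps)
  qed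
  have "(1 + \<bar>x1\<bar>) * ((1 + \<bar>x2\<bar>) * ((1 + \<bar>x3\<bar>) * ((1 + \<bar>x4\<bar>) * (1 + \<bar>x5\<bar>)))) \<le>
      (2 * x1) * ((2 * \<bar>x2\<bar>) * ((2 * \<bar>x2\<bar>) * ((3 * \<bar>a\<bar>) * (1 + \<bar>x5\<bar>))))"
    using pos x2nz x32 e by (intro mult_mono) auto
  also have "\<dots> = 24 * (x1 * \<bar>x2\<bar>) * \<bar>a\<bar> * ((1 + \<bar>x5\<bar>) * \<bar>x2\<bar>)"
    by (simp add: algebra_simps)
  also have "\<dots> = 24 * \<bar>a\<bar> * \<bar>a\<bar> * ((1 + \<bar>x5\<bar>) * \<bar>x2\<bar>)"
    by (simp only: abs_a)
  also have "\<dots> \<le> 24 * \<bar>a\<bar> * \<bar>a\<bar> * (3 * \<bar>a\<bar>)"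
    by (intro mult_left_mono t) auto
  also have "\<dots> = 72 * \<bar>a\<bar> ^ 3" by (simp add: power3_eq_cube)
  finally show ?thesis .
qed

lemma height_le_decay5:
  assumes p: "p \<in> quadric_chart"
  shows "1 / (real_of_int (height p))\<^sup>2 \<le> 72 powr (4 / 3) * decay5 (chart_coordinates p)"
proof -
  obtain a b c d e where p_eq: "p = (a, b, c, d, e)" by (cases p)
  obtain x1 x2 x3 x4 x5 where x: "chart_coordinates p = (x1, x2, x3, x4, x5)"
    by (cases "chart_coordinates p")
  have a: "a \<noteq> 0" using p p_eq quadric_chart_nonzero by blast
  define P where "P = (1 + \<bar>x1\<bar>) * ((1 + \<bar>x2\<bar>) * ((1 + \<bar>x3\<bar>) * ((1 + \<bar>x4\<bar>) * (1 + \<bar>x5\<bar>))))"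
  have P: "0 < P" "P \<le> 72 * \<bar>a\<bar> ^ 3"
    using chart_coordinates_size p x unfolding p_eq P_def by auto
  have d5: "decay5 (chart_coordinates p) = real_of_int P powr (- 4 / 3)"
  proof -
    have "real_of_int P = (1 + \<bar>real_of_int x1\<bar>) * ((1 + \<bar>real_of_int x2\<bar>) * ((1 + \<bar>real_of_int x3\<bar>) *
        ((1 + \<bar>real_of_int x4\<bar>) * (1 + \<bar>real_of_int x5\<bar>))))"
      by (simp only: P_def of_int_mult of_int_add of_int_1 of_int_abs)
    then show ?thesis
      by (simp only: x decay5_def decay_def prod.case powr_mult)
  qed
  have "(72 * \<bar>real_of_int a\<bar> ^ 3) powr (- 4 / 3) \<le> real_of_int P powr (- 4 / 3)"
  proof (rule powr_mono2')
    show "real_of_int P \<le> 72 * \<bar>real_of_int a\<bar> ^ 3"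
    proof -
      have "real_of_int P \<le> real_of_int (72 * \<bar>a\<bar> ^ 3)"
        using P(2) by (simp only: of_int_le_iff)
      then show ?thesis by simp
    qed
  qed (use P in auto)
  moreover have "(72 * \<bar>real_of_int a\<bar> ^ 3) powr (- 4 / 3) = 72 powr (- 4 / 3) * (1 / (real_of_int a) ^ 4)"
  proof -
    have cube: "\<bar>real_of_int a\<bar> ^ 3 = \<bar>real_of_int a\<bar> powr 3"
      using a by simp
    have "(\<bar>real_of_int a\<bar> ^ 3) powr (- 4 / 3) = \<bar>real_of_int a\<bar> powr (3 * (- 4 / 3))"
      unfolding cube by (rule powr_powr)
    also have "3 * (- 4 / 3) = (- 4 :: real)" by simp
    also have "\<bar>real_of_int a\<bar> powr (- 4) = 1 / \<bar>real_of_int a\<bar> powr 4"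
      by (rule powr_minus_divide)
    also have "\<bar>real_of_int a\<bar> powr 4 = (real_of_int a) ^ 4"
      using a by simp
    finally show ?thesis by (simp only: powr_mult)
  qed
  ultimately have "72 powr (- 4 / 3) * (1 / (real_of_int a) ^ 4) \<le> decay5 (chart_coordinates p)"
    by (simp add: d5)
  then have "72 powr (4 / 3) * (72 powr (- 4 / 3) * (1 / (real_of_int a) ^ 4)) \<le>
      72 powr (4 / 3) * decay5 (chart_coordinates p)"
    by (intro mult_left_mono) auto
  also have "72 powr (4 / 3) * (72 powr (- 4 / 3) * (1 / (real_of_int a) ^ 4)) = 1 / (real_of_int a) ^ 4"
    by (simp add: powr_minus)
  finally have main: "1 / (real_of_int a) ^ 4 \<le> 72 powr (4 / 3) * decay5 (chart_coordinates p)" .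
  have "(real_of_int a)\<^sup>2 \<le> real_of_int (height p)"
    by (simp add: p_eq height_def flip: of_int_power of_int_add)
  then have "((real_of_int a)\<^sup>2)\<^sup>2 \<le> (real_of_int (height p))\<^sup>2"
    by (intro power_mono) auto
  then have "1 / (real_of_int (height p))\<^sup>2 \<le> 1 / (real_of_int a) ^ 4"
    using a by (intro divide_left_mono) (auto simp: power_even_eq intro!: mult_pos_pos)
  with main show ?thesis by linarith
qed

text \<open>The quadric is covered by the chart and its images under three permutations of the coordinates
  that preserve both the equation and the height.\<close>

lemma summable_on_quadric: "(\<lambda>p. 1 / (real_of_int (height p))\<^sup>2) summable_on quadric"
proof -
  let ?f = "\<lambda>p. 1 / (real_of_int (height p))\<^sup>2"
  have "decay5 summable_on chart_coordinates ` quadric_chart"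
    by (rule summable_on_subset_banach[OF decay5_summable]) auto
  then have "(\<lambda>p. 72 powr (4 / 3) * decay5 (chart_coordinates p)) summable_on quadric_chart"
    by (intro summable_on_cmult_right) (simp add: summable_on_reindex[OF inj_chart_coordinates] o_def)
  then have chart: "?f summable_on quadric_chart"
    by (rule summable_on_comparison_test) (use height_le_decay5 in auto)
  have translate: "?f summable_on {p \<in> quadric. \<sigma> p \<in> quadric_chart}"
    if "inj \<sigma>" "\<And>p. height (\<sigma> p) = height p" for \<sigma>
  proof -
    let ?A = "{p \<in> quadric. \<sigma> p \<in> quadric_chart}"
    have "?f summable_on \<sigma> ` ?A"
      by (rule summable_on_subset_banach[OF chart]) auto
    then have "(?f \<circ> \<sigma>) summable_on ?A"
      by (subst (asm) summable_on_reindex) (use that(1) in \<open>auto intro: inj_on_subset\<close>)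
    then show ?thesis by (simp add: o_def that(2))
  qed
  let ?s1 = "(\<lambda>(a, b, c, d, e). (b, a, c, d, e)) :: quintuple \<Rightarrow> quintuple"
  let ?s2 = "(\<lambda>(a, b, c, d, e). (c, d, a, b, e)) :: quintuple \<Rightarrow> quintuple"
  let ?s3 = "(\<lambda>(a, b, c, d, e). (d, c, a, b, e)) :: quintuple \<Rightarrow> quintuple"
  let ?A = "\<lambda>\<sigma>. {p \<in> quadric. \<sigma> p \<in> quadric_chart}"
  have "?f summable_on (quadric_chart \<union> ?A ?s1 \<union> (?A ?s2 \<union> ?A ?s3))"
    by (intro summable_on_Un_real chart translate) (auto simp: inj_on_def height_def)
  moreover have "quadric \<subseteq> quadric_chart \<union> ?A ?s1 \<union> (?A ?s2 \<union> ?A ?s3)"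
  proof
    fix p assume p: "p \<in> quadric"
    obtain a b c d e where p_eq: "p = (a, b, c, d, e)" by (cases p)
    have "(b, a, c, d, e) \<in> quadric" "(c, d, a, b, e) \<in> quadric" "(d, c, a, b, e) \<in> quadric"
      using p unfolding p_eq quadric_def by (auto simp: algebra_simps)
    with p show "p \<in> quadric_chart \<union> ?A ?s1 \<union> (?A ?s2 \<union> ?A ?s3)"
      unfolding p_eq quadric_chart_def by auto
  qed
  ultimately show ?thesis by (rule summable_on_subset_banach)
qed

section \<open>Symplectic matrices and Pluecker coordinates\<close>

lemma UNIV_22: "(UNIV :: (2 + 2) set) = {Inl 1, Inl 2, Inr 1, Inr 2}"
  using exhaust_2 by (auto simp: UNIV_2 simp flip: UNIV_Plus_UNIV)

lemma sum_22: "sum f (UNIV :: (2 + 2) set) = f (Inl 1) + f (Inl 2) + (f (Inr 1) + f (Inr 2))"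
  by (simp add: UNIV_22 add.assoc)

lemma forall_22: "(\<forall>u :: 2 + 2. P u) \<longleftrightarrow> P (Inl 1) \<and> P (Inl 2) \<and> P (Inr 1) \<and> P (Inr 2)"
proof -
  have "(\<forall>u :: 2 + 2. P u) \<longleftrightarrow> (\<forall>u\<in>UNIV. P u)" by simp
  then show ?thesis unfolding UNIV_22 by simp
qed

lemma symplectic_J_nth [simp]:
  "symplectic_J $ Inl i $ Inl j = 0" "symplectic_J $ Inr i $ Inr j = 0"
  "symplectic_J $ Inl i $ Inr j = (if i = j then 1 else 0)"
  "symplectic_J $ Inr i $ Inl j = (if i = j then - 1 else 0)"
  by (simp_all add: symplectic_J_def)

lemma symplectic_J_square: "symplectic_J ** symplectic_J = - mat 1"
  by (simp add: vec_eq_iff forall_22 matrix_matrix_mult_def sum_22 mat_def)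

definition symplectic_inverse :: "mat4 \<Rightarrow> mat4" where
  "symplectic_inverse M = - (symplectic_J ** transpose M ** symplectic_J)"

text \<open>The alternating form with matrix \<open>symplectic_J\<close>, on row vectors.\<close>

definition symplectic_pairing :: "real^(2 + 2) \<Rightarrow> real^(2 + 2) \<Rightarrow> real" where
  "symplectic_pairing x y = (\<Sum>i\<in>UNIV. x $ Inl i * y $ Inr i - x $ Inr i * y $ Inl i)"

lemma matrix_mult_minus:
  fixes A B :: mat4
  shows "(- A) ** B = - (A ** B)" "A ** (- B) = - (A ** B)"
  by (simp_all add: vec_eq_iff matrix_matrix_mult_def sum_negf)

lemma symplectic_inverse:
  assumes "M \<in> Sp4_Z"
  shows "symplectic_inverse M ** M = mat 1" "M ** symplectic_inverse M = mat 1"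
proof -
  have M: "transpose M ** symplectic_J ** M = symplectic_J"
    using assms by (simp add: Sp4_Z_def)
  have "symplectic_inverse M ** M = - (symplectic_J ** (transpose M ** symplectic_J ** M))"
    by (simp add: symplectic_inverse_def matrix_mult_minus matrix_mul_assoc)
  then show l: "symplectic_inverse M ** M = mat 1"
    unfolding M symplectic_J_square by simp
  then show "M ** symplectic_inverse M = mat 1"
    by (simp add: matrix_left_right_inverse)
qed

text \<open>Symplectic matrices are defined by a condition on their columns.  Since \<open>- J M\<^sup>T J\<close> is then also a
  right inverse of \<open>M\<close>, the rows satisfy the same condition.\<close>

lemma symplectic_rows:
  assumes "M \<in> Sp4_Z"
  shows "symplectic_pairing (M $ u) (M $ v) = symplectic_J $ u $ v"
proof -
  have "M ** symplectic_J ** transpose M = symplectic_J"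
  proof -
    have "M ** symplectic_J ** transpose M = - (M ** symplectic_J ** transpose M ** (symplectic_J ** symplectic_J))"
      by (simp add: symplectic_J_square matrix_mult_minus)
    also have "\<dots> = (M ** symplectic_inverse M) ** symplectic_J"
      by (simp add: symplectic_inverse_def matrix_mult_minus matrix_mul_assoc)
    also have "\<dots> = symplectic_J"
      using symplectic_inverse[OF assms] by simp
    finally show ?thesis .
  qed
  moreover have "(M ** symplectic_J ** transpose M) $ u $ v = symplectic_pairing (M $ u) (M $ v)"
    by (simp add: matrix_matrix_mult_def sum_22 symplectic_pairing_def sum_2 transpose_def algebra_simps)
  ultimately show ?thesis by simp
qed

lemma mat_1_in_Sp4_Z: "mat 1 \<in> Sp4_Z"
proof -
  have "(mat 1 :: mat4) $ u $ v \<in> \<int>" for u v by (simp add: mat_def)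
  then show ?thesis by (simp add: Sp4_Z_def transpose_mat)
qed

lemma Sp4_Z_mult:
  assumes "M \<in> Sp4_Z" "N \<in> Sp4_Z"
  shows "M ** N \<in> Sp4_Z"
proof -
  have "transpose (M ** N) ** symplectic_J ** (M ** N) =
      transpose N ** (transpose M ** symplectic_J ** M) ** N"
    by (simp add: matrix_transpose_mul matrix_mul_assoc)
  then have "transpose (M ** N) ** symplectic_J ** (M ** N) = symplectic_J"
    using assms by (simp add: Sp4_Z_def)
  moreover have "(M ** N) $ u $ v \<in> \<int>" for u v
    using assms by (simp add: Sp4_Z_def matrix_matrix_mult_def Ints_sum)
  ultimately show ?thesis by (simp add: Sp4_Z_def)
qed

lemma Sp4_Z_inverse:
  assumes "M \<in> Sp4_Z"
  shows "symplectic_inverse M \<in> Sp4_Z"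
proof -
  let ?N = "symplectic_inverse M"
  have "transpose ?N ** symplectic_J ** ?N = transpose ?N ** (transpose M ** symplectic_J ** M) ** ?N"
    using assms by (simp add: Sp4_Z_def)
  also have "\<dots> = transpose (M ** ?N) ** symplectic_J ** (M ** ?N)"
    by (simp add: matrix_transpose_mul matrix_mul_assoc)
  also have "\<dots> = symplectic_J"
    using symplectic_inverse[OF assms] by (simp add: transpose_mat)
  finally have "transpose ?N ** symplectic_J ** ?N = symplectic_J" .
  moreover have "?N $ u $ v \<in> \<int>" for u v
  proof -
    have J: "symplectic_J $ x $ y \<in> \<int>" for x y
      by (cases x; cases y) auto
    have "M $ x $ y \<in> \<int>" for x y using assms by (simp add: Sp4_Z_def)
    with J show ?thesis
      by (auto simp: symplectic_inverse_def matrix_matrix_mult_def transpose_def intro!: Ints_sum Ints_mult Ints_minus)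
  qed
  ultimately show ?thesis by (simp add: Sp4_Z_def)
qed

text \<open>Two matrices are thus in the same coset of \<open>Sp4_Z_inf\<close> if and only if their lower rows are
  orthogonal for the symplectic pairing.\<close>

lemma block_C_mult_inverse:
  "block_C (M ** symplectic_inverse N) $ i $ j = of_real (symplectic_pairing (M $ Inr i) (N $ Inr j))"
  using exhaust_2[of j]
  by (auto simp: block_C_def symplectic_inverse_def matrix_matrix_mult_def sum_22 sum_2
      symplectic_pairing_def transpose_def algebra_simps)

lemma Sp4_Z_inf_iff: "M \<in> Sp4_Z_inf \<longleftrightarrow> M \<in> Sp4_Z \<and> (\<forall>i j. M $ Inr i $ Inl j = 0)"
  by (auto simp: Sp4_Z_inf_def block_C_def vec_eq_iff)

lemma mat_1_in_Sp4_Z_inf: "mat 1 \<in> Sp4_Z_inf"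
  by (simp add: Sp4_Z_inf_iff mat_1_in_Sp4_Z) (simp add: mat_def)

lemma Sp4_Z_inf_mult:
  assumes "M \<in> Sp4_Z_inf" "N \<in> Sp4_Z_inf"
  shows "M ** N \<in> Sp4_Z_inf"
proof -
  have "(M ** N) $ Inr i $ Inl j = 0" for i j
    using assms by (simp add: Sp4_Z_inf_iff matrix_matrix_mult_def sum_22)
  then show ?thesis
    using assms by (simp add: Sp4_Z_inf_iff Sp4_Z_mult)
qed

lemma Sp4_Z_inf_inverse:
  assumes "M \<in> Sp4_Z_inf"
  shows "symplectic_inverse M \<in> Sp4_Z_inf"
proof -
  have "symplectic_inverse M $ Inr i $ Inl j = 0" for i j
    using assms exhaust_2[of i] exhaust_2[of j]
    by (auto simp: Sp4_Z_inf_iff symplectic_inverse_def matrix_matrix_mult_def sum_22 transpose_def)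
  then show ?thesis
    using assms Sp4_Z_inverse by (auto simp: Sp4_Z_inf_iff)
qed

abbreviation coset :: "mat4 \<Rightarrow> mat4 set" where
  "coset M \<equiv> (\<lambda>h. h ** M) ` Sp4_Z_inf"

lemma coset_eqI:
  assumes M: "M \<in> Sp4_Z" and N: "N \<in> Sp4_Z_inf"
  shows "coset (N ** M) = coset M"
proof
  show "coset (N ** M) \<subseteq> coset M"
    using Sp4_Z_inf_mult[OF _ N] by (auto simp: matrix_mul_assoc)
  show "coset M \<subseteq> coset (N ** M)"
  proof
    fix Y assume "Y \<in> coset M"
    then obtain h where h: "h \<in> Sp4_Z_inf" "Y = h ** M" by auto
    have "Y = (h ** symplectic_inverse N) ** (N ** M)"
      using symplectic_inverse(1)[of N] N h
      by (metis Sp4_Z_inf_iff matrix_mul_assoc matrix_mul_rid)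
    moreover have "h ** symplectic_inverse N \<in> Sp4_Z_inf"
      using h N by (intro Sp4_Z_inf_mult Sp4_Z_inf_inverse)
    ultimately show "Y \<in> coset (N ** M)" by blast
  qed
qed

abbreviation cosets :: "mat4 set set" where
  "cosets \<equiv> left_quotient Sp4_Z_inf Sp4_Z"

definition coset_rep :: "mat4 set \<Rightarrow> mat4" where
  "coset_rep C = (SOME M. M \<in> C)"

lemma coset_rep:
  assumes "C \<in> cosets"
  shows "coset_rep C \<in> Sp4_Z" "C = coset (coset_rep C)"
proof -
  from assms obtain g where g: "g \<in> Sp4_Z" "C = coset g"
    by (auto simp: left_quotient_def)
  have "mat 1 ** g \<in> C" using g mat_1_in_Sp4_Z_inf by blast
  then have "coset_rep C \<in> C"
    unfolding coset_rep_def by (rule someI)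
  then obtain h where h: "h \<in> Sp4_Z_inf" "coset_rep C = h ** g"
    using g by auto
  then show "coset_rep C \<in> Sp4_Z" using g by (simp add: Sp4_Z_mult Sp4_Z_inf_iff)
  have "coset (coset_rep C) = coset g"
    unfolding h(2) by (rule coset_eqI[OF g(1) h(1)])
  then show "C = coset (coset_rep C)"
    using g(2) by simp
qed

lemma Sp4_Z_inf_coset:
  assumes "M \<in> Sp4_Z_inf"
  shows "coset M = Sp4_Z_inf"
proof -
  have "coset (M ** mat 1) = coset (mat 1)"
    using assms by (intro coset_eqI mat_1_in_Sp4_Z)
  then show ?thesis by simp
qed

lemma Sp4_Z_inf_in_cosets: "Sp4_Z_inf \<in> cosets"
  using Sp4_Z_inf_coset[OF mat_1_in_Sp4_Z_inf] mat_1_in_Sp4_Z unfolding left_quotient_def by blast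

definition minor :: "mat4 \<Rightarrow> 2 + 2 \<Rightarrow> 2 + 2 \<Rightarrow> real" where
  "minor M u v = M $ Inr 1 $ u * M $ Inr 2 $ v - M $ Inr 1 $ v * M $ Inr 2 $ u"

text \<open>Three vectors in the plane are linearly dependent, with the minors as coefficients.  The columns
  of the lower half of \<open>M\<close> are such vectors.\<close>

lemma minor_exchange:
  "minor M u v * M $ Inr i $ l = M $ Inr i $ u * minor M l v + M $ Inr i $ v * minor M u l"
  using exhaust_2[of i] by (auto simp: minor_def algebra_simps)

lemma pairing_minor:
  assumes "M \<in> Sp4_Z"
  shows "symplectic_pairing (\<chi> l. minor M l v) (M $ Inr j) = 0"
    "symplectic_pairing (\<chi> l. minor M u l) (M $ Inr j) = 0"
proof -
  have "symplectic_pairing (\<chi> l. minor M l v) y =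
      symplectic_pairing (M $ Inr 1) y * M $ Inr 2 $ v - M $ Inr 1 $ v * symplectic_pairing (M $ Inr 2) y"
    "symplectic_pairing (\<chi> l. minor M u l) y =
      M $ Inr 1 $ u * symplectic_pairing (M $ Inr 2) y - symplectic_pairing (M $ Inr 1) y * M $ Inr 2 $ u" for y
    by (simp_all add: symplectic_pairing_def sum_2 minor_def algebra_simps)
  then show "symplectic_pairing (\<chi> l. minor M l v) (M $ Inr j) = 0"
    "symplectic_pairing (\<chi> l. minor M u l) (M $ Inr j) = 0"
    by (simp_all add: symplectic_rows[OF assms])
qed

lemma minor_nonzero:
  assumes "M \<in> Sp4_Z"
  obtains u v where "minor M u v \<noteq> 0"
proof -
  have "\<exists>u v. minor M u v \<noteq> 0"
  proof (rule ccontr)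
    assume "\<not> ?thesis"
    then have eq: "M $ Inr 1 $ u * M $ Inr 2 $ v = M $ Inr 1 $ v * M $ Inr 2 $ u" for u v
      by (auto simp: minor_def)
    have lin: "symplectic_pairing x (M $ Inr 1) * M $ Inr 2 $ v = M $ Inr 1 $ v * symplectic_pairing x (M $ Inr 2)" for x v
    proof -
      have "symplectic_pairing x (M $ Inr 1) * M $ Inr 2 $ v =
          (\<Sum>i\<in>UNIV. x $ Inl i * (M $ Inr 1 $ Inr i * M $ Inr 2 $ v) - x $ Inr i * (M $ Inr 1 $ Inl i * M $ Inr 2 $ v))"
        by (simp add: symplectic_pairing_def sum_2 algebra_simps)
      also have "\<dots> = (\<Sum>i\<in>UNIV. x $ Inl i * (M $ Inr 1 $ v * M $ Inr 2 $ Inr i) - x $ Inr i * (M $ Inr 1 $ v * M $ Inr 2 $ Inl i))"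
        by (simp only: eq[of _ v])
      also have "\<dots> = M $ Inr 1 $ v * symplectic_pairing x (M $ Inr 2)"
        by (simp add: symplectic_pairing_def sum_2 algebra_simps)
      finally show ?thesis .
    qed
    have "M $ Inr 2 $ v = 0" for v
      using lin[of "M $ Inl 1" v] by (simp add: symplectic_rows[OF assms])
    then have "symplectic_pairing (M $ Inl 2) (M $ Inr 2) = 0"
      by (simp add: symplectic_pairing_def)
    then show False by (simp add: symplectic_rows[OF assms])
  qed
  with that show ?thesis by blast
qed

text \<open>By \<open>minor_exchange\<close>, each lower row of \<open>M\<close> is, after multiplication by a minor, a combination of
  the vectors of minors of \<open>N\<close> with one fixed column index.  These are combinations of the lower
  rows of \<open>N\<close>, which span an isotropic plane, so they are orthogonal to the lower rows of \<open>N\<close>.\<close>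

lemma coset_eq_if_minors_eq:
  assumes M: "M \<in> Sp4_Z" and N: "N \<in> Sp4_Z" and eq: "\<And>u v. minor M u v = minor N u v"
  shows "coset M = coset N"
proof -
  obtain u v where uv: "minor M u v \<noteq> 0" using minor_nonzero[OF M] .
  have "symplectic_pairing (M $ Inr i) (N $ Inr j) = 0" for i j
  proof -
    have "minor N u v * M $ Inr i $ l = M $ Inr i $ u * minor N l v + M $ Inr i $ v * minor N u l" for l
      using minor_exchange[of M u v i l] by (simp only: eq)
    then have "(\<chi> l. minor N u v * M $ Inr i $ l) =
        (\<chi> l. M $ Inr i $ u * minor N l v + M $ Inr i $ v * minor N u l)"
      by simp
    then have "symplectic_pairing (\<chi> l. minor N u v * M $ Inr i $ l) (N $ Inr j) =
        symplectic_pairing (\<chi> l. M $ Inr i $ u * minor N l v + M $ Inr i $ v * minor N u l) (N $ Inr j)"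
      by simp
    then have "minor N u v * symplectic_pairing (M $ Inr i) (N $ Inr j) =
        M $ Inr i $ u * symplectic_pairing (\<chi> l. minor N l v) (N $ Inr j) +
        M $ Inr i $ v * symplectic_pairing (\<chi> l. minor N u l) (N $ Inr j)"
      by (simp add: symplectic_pairing_def sum_2 algebra_simps)
    with uv eq show ?thesis by (simp add: pairing_minor[OF N])
  qed
  then have "M ** symplectic_inverse N \<in> Sp4_Z_inf"
    unfolding Sp4_Z_inf_def using M N
    by (simp add: vec_eq_iff block_C_mult_inverse Sp4_Z_mult Sp4_Z_inverse)
  moreover have "M ** symplectic_inverse N ** N = M"
    using symplectic_inverse(1)[OF N] by (metis matrix_mul_assoc matrix_mul_rid)
  ultimately show ?thesis
    using coset_eqI[OF N] by metis
qed

text \<open>The minors of a matrix in \<open>Sp4_Z\<close> are integers, so the floor function only changes their type.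
  The sixth minor, on the columns \<open>Inl 2\<close> and \<open>Inr 2\<close>, is the negative of the fifth because the
  lower rows are orthogonal for the pairing.\<close>

definition pluecker :: "mat4 \<Rightarrow> quintuple" where
  "pluecker M = (\<lfloor>minor M (Inl 1) (Inl 2)\<rfloor>, \<lfloor>minor M (Inr 1) (Inr 2)\<rfloor>,
     \<lfloor>minor M (Inl 1) (Inr 2)\<rfloor>, \<lfloor>minor M (Inl 2) (Inr 1)\<rfloor>, \<lfloor>minor M (Inl 1) (Inr 1)\<rfloor>)"

lemma minor_Ints:
  assumes "M \<in> Sp4_Z"
  shows "minor M u v = of_int \<lfloor>minor M u v\<rfloor>"
proof -
  have "minor M u v \<in> \<int>"
    using assms by (simp add: minor_def Sp4_Z_def)
  then show ?thesis by simp
qed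

lemma minor_isotropic:
  assumes "M \<in> Sp4_Z"
  shows "minor M (Inl 2) (Inr 2) = - minor M (Inl 1) (Inr 1)"
  using symplectic_rows[OF assms, of "Inr 1" "Inr 2"]
  by (simp add: symplectic_pairing_def sum_2 minor_def algebra_simps)

lemma minors_from_pluecker:
  assumes M: "M \<in> Sp4_Z" and pl: "pluecker M = (a, b, c, d, e)"
  shows "minor M (Inl 1) (Inl 2) = of_int a" "minor M (Inr 1) (Inr 2) = of_int b"
    "minor M (Inl 1) (Inr 2) = of_int c" "minor M (Inl 2) (Inr 1) = of_int d"
    "minor M (Inl 1) (Inr 1) = of_int e" "minor M (Inl 2) (Inr 2) = - of_int e"
proof -
  from pl have "a = \<lfloor>minor M (Inl 1) (Inl 2)\<rfloor>" "b = \<lfloor>minor M (Inr 1) (Inr 2)\<rfloor>"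
     "c = \<lfloor>minor M (Inl 1) (Inr 2)\<rfloor>" "d = \<lfloor>minor M (Inl 2) (Inr 1)\<rfloor>" "e = \<lfloor>minor M (Inl 1) (Inr 1)\<rfloor>"
    by (auto simp: pluecker_def)
  then show "minor M (Inl 1) (Inl 2) = of_int a" "minor M (Inr 1) (Inr 2) = of_int b"
    "minor M (Inl 1) (Inr 2) = of_int c" "minor M (Inl 2) (Inr 1) = of_int d"
    "minor M (Inl 1) (Inr 1) = of_int e" "minor M (Inl 2) (Inr 2) = - of_int e"
    using minor_Ints[OF M] by (simp_all add: minor_isotropic[OF M])
qed

lemma minor_antisym: "minor M v u = - minor M u v" "minor M u u = 0"
  by (simp_all add: minor_def)

lemma coset_eq_if_pluecker_eq:
  assumes M: "M \<in> Sp4_Z" and N: "N \<in> Sp4_Z" and eq: "pluecker M = pluecker N"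
  shows "coset M = coset N"
proof (rule coset_eq_if_minors_eq[OF M N])
  obtain a b c d e where M': "pluecker M = (a, b, c, d, e)" by (cases "pluecker M")
  then have N': "pluecker N = (a, b, c, d, e)" using eq by simp
  note vals = minors_from_pluecker[OF M M'] minors_from_pluecker[OF N N']
  have "\<forall>u v. minor M u v = minor N u v"
    unfolding forall_22
    by (simp add: vals minor_antisym(2) minor_antisym(1)[of _ _ "Inl 1"]
        minor_antisym(1)[of _ "Inr 1" "Inl 2"] minor_antisym(1)[of _ "Inr 2" "Inl 2"]
        minor_antisym(1)[of _ "Inr 2" "Inr 1"])
  then show "minor M u v = minor N u v" for u v by blast
qed

text \<open>This is the Pluecker relation between the \<open>2 \<times> 2\<close> minors of a \<open>2 \<times> 4\<close> matrix.\<close>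

lemma pluecker_in_quadric:
  assumes M: "M \<in> Sp4_Z"
  shows "pluecker M \<in> quadric"
proof -
  obtain a b c d e where pl: "pluecker M = (a, b, c, d, e)" by (cases "pluecker M")
  note vals = minors_from_pluecker[OF M pl]
  have "minor M (Inl 1) (Inl 2) * minor M (Inr 1) (Inr 2) + minor M (Inl 1) (Inr 2) * minor M (Inl 2) (Inr 1)
      - minor M (Inl 1) (Inr 1) * minor M (Inl 2) (Inr 2) = 0"
    by (simp add: minor_def algebra_simps)
  then have "of_int (a * b + c * d + e\<^sup>2) = (0 :: real)"
    unfolding vals by (simp add: power2_eq_square)
  then have "a * b + c * d + e\<^sup>2 = 0" by (simp only: of_int_eq_0_iff)
  moreover have "(a, b, c, d, e) \<noteq> (0, 0, 0, 0, 0)"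
  proof
    assume "(a, b, c, d, e) = (0, 0, 0, 0, 0)"
    then have "\<forall>u v. minor M u v = 0"
      unfolding forall_22 using vals
      by (simp add: minor_antisym(2) minor_antisym(1)[of _ _ "Inl 1"]
        minor_antisym(1)[of _ "Inr 1" "Inl 2"] minor_antisym(1)[of _ "Inr 2" "Inl 2"]
        minor_antisym(1)[of _ "Inr 2" "Inr 1"])
    then show False using minor_nonzero[OF M] by blast
  qed
  ultimately show ?thesis by (simp add: pl quadric_def)
qed

lemma pluecker_cusp:
  assumes M: "M \<in> Sp4_Z" and pl: "pluecker M = (0, b, 0, 0, 0)"
  shows "M \<in> Sp4_Z_inf"
proof -
  note vals = minors_from_pluecker[OF M pl]
  have "b \<noteq> 0" using pluecker_in_quadric[OF M] by (auto simp: pl quadric_def)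
  moreover have "minor M (Inr 1) (Inr 2) * M $ Inr i $ Inl j = 0" for i j
    unfolding minor_exchange[of M "Inr 1" "Inr 2"] using exhaust_2[of j] vals
    by (auto simp: minor_antisym(1)[of _ "Inr 1" "Inl _"])
  ultimately show ?thesis
    using M vals(2) by (auto simp: Sp4_Z_inf_iff)
qed

lemma det_product_2:
  fixes a b c d x y z w :: real
  shows "(a * d - b * c) * (x * w - y * z) = (a * x + b * y) * (c * z + d * w) - (a * z + b * w) * (c * x + d * y)"
  by (simp add: algebra_simps)

text \<open>For \<open>C = 0\<close> the diagonal blocks satisfy \<open>A D\<^sup>T = 1\<close>, so \<open>b = det D\<close> is a unit in the
  integers.\<close>

lemma pluecker_of_cusp:
  assumes "M \<in> Sp4_Z_inf"
  obtains b where "pluecker M = (0, b, 0, 0, 0)" "b = 1 \<or> b = -1"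
proof -
  have M: "M \<in> Sp4_Z" and C: "M $ Inr i $ Inl j = 0" for i j
    using assms by (auto simp: Sp4_Z_inf_iff)
  obtain a b c d e where pl: "pluecker M = (a, b, c, d, e)" by (cases "pluecker M")
  note vals = minors_from_pluecker[OF M pl]
  have zero: "a = 0" "c = 0" "d = 0" "e = 0"
    using vals(1,3,4,5) C by (auto simp: minor_def)
  define A where "A = M $ Inl 1 $ Inl 1 * M $ Inl 2 $ Inl 2 - M $ Inl 1 $ Inl 2 * M $ Inl 2 $ Inl 1"
  have rows: "M $ Inl i $ Inl 1 * M $ Inr j $ Inr 1 + M $ Inl i $ Inl 2 * M $ Inr j $ Inr 2 = (if i = j then 1 else 0)" for i j
    using symplectic_rows[OF M, of "Inl i" "Inr j"] by (simp add: symplectic_pairing_def sum_2 C)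
  have "A * minor M (Inr 1) (Inr 2) =
      (M $ Inl 1 $ Inl 1 * M $ Inr 1 $ Inr 1 + M $ Inl 1 $ Inl 2 * M $ Inr 1 $ Inr 2) *
      (M $ Inl 2 $ Inl 1 * M $ Inr 2 $ Inr 1 + M $ Inl 2 $ Inl 2 * M $ Inr 2 $ Inr 2) -
      (M $ Inl 1 $ Inl 1 * M $ Inr 2 $ Inr 1 + M $ Inl 1 $ Inl 2 * M $ Inr 2 $ Inr 2) *
      (M $ Inl 2 $ Inl 1 * M $ Inr 1 $ Inr 1 + M $ Inl 2 $ Inl 2 * M $ Inr 1 $ Inr 2)"
    unfolding A_def minor_def by (rule det_product_2)
  also have "\<dots> = 1"
    unfolding rows by simp
  finally have "A * of_int b = 1" by (simp add: vals)
  moreover have "A \<in> \<int>"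
    using M by (auto simp: A_def Sp4_Z_def)
  then obtain n where "A = of_int n" by (elim Ints_cases)
  ultimately have "of_int (n * b) = (1 :: real)" by simp
  then have "n * b = 1" by (simp only: of_int_eq_1_iff)
  then have "b = 1 \<or> b = -1" by (metis mult.commute pos_zmult_eq_1_iff_lemma zmult_eq_1_iff)
  with that pl zero show ?thesis by simp
qed

text \<open>Real and imaginary part of \<open>det (iyC + D)\<close> are \<open>b - y\<^sup>2 a\<close> and \<open>y (c - d)\<close>; the mixed terms
  \<open>- 2 y\<^sup>2 (ab + cd)\<close> of the squares become \<open>2 y\<^sup>2 e\<^sup>2\<close> on the quadric.\<close>

lemma norm_siegel_j:
  assumes M: "M \<in> Sp4_Z" and pl: "pluecker M = (a, b, c, d, e)"
  shows "(norm (siegel_j M (diag_point y y)))\<^sup>2 =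
    (of_int b)\<^sup>2 + y ^ 4 * (of_int a)\<^sup>2 + y\<^sup>2 * ((of_int c)\<^sup>2 + (of_int d)\<^sup>2 + 2 * (of_int e)\<^sup>2)"
    and "a = 0 \<Longrightarrow> c = 0 \<Longrightarrow> d = 0 \<Longrightarrow> siegel_j M (diag_point y y) = of_int b"
proof -
  note vals = minors_from_pluecker[OF M pl]
  have "siegel_j M (diag_point y y) =
      of_real (minor M (Inr 1) (Inr 2) - y\<^sup>2 * minor M (Inl 1) (Inl 2))
      + \<i> * of_real (y * (minor M (Inl 1) (Inr 2) - minor M (Inl 2) (Inr 1)))"
    by (simp add: siegel_j_def det_2 block_C_def block_D_def matrix_matrix_mult_def sum_2 minor_def
        algebra_simps power2_eq_square)
  then have j: "siegel_j M (diag_point y y) = Complex (of_int b - y\<^sup>2 * of_int a) (y * (of_int c - of_int d))"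
    unfolding vals by (simp add: complex_eq_iff)
  then show "a = 0 \<Longrightarrow> c = 0 \<Longrightarrow> d = 0 \<Longrightarrow> siegel_j M (diag_point y y) = of_int b"
    by (simp add: complex_eq_iff)
  have "a * b + c * d + e\<^sup>2 = 0"
    using pluecker_in_quadric[OF M] by (auto simp: pl quadric_def)
  then have "of_int (a * b + c * d + e\<^sup>2) = (0 :: real)" by simp
  then have "(of_int e :: real)\<^sup>2 = - of_int a * of_int b - of_int c * of_int d"
    by simp
  then show "(norm (siegel_j M (diag_point y y)))\<^sup>2 =
    (of_int b)\<^sup>2 + y ^ 4 * (of_int a)\<^sup>2 + y\<^sup>2 * ((of_int c)\<^sup>2 + (of_int d)\<^sup>2 + 2 * (of_int e)\<^sup>2)"
  proof -
    have "(norm (siegel_j M (diag_point y y)))\<^sup>2 =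
        (of_int b - y\<^sup>2 * of_int a)\<^sup>2 + (y * (of_int c - of_int d))\<^sup>2"
      by (simp add: j cmod_power2)
    also have "\<dots> = (of_int b)\<^sup>2 + y ^ 4 * (of_int a)\<^sup>2 +
        y\<^sup>2 * ((of_int c)\<^sup>2 + (of_int d)\<^sup>2 + 2 * (- of_int a * of_int b - of_int c * of_int d))"
      by (simp add: power2_eq_square power4_eq_xxxx algebra_simps)
    finally show ?thesis
      using \<open>(of_int e :: real)\<^sup>2 = - of_int a * of_int b - of_int c * of_int d\<close> by simp
  qed
qed

section \<open>The constant term of the Eisenstein series\<close>

lemma height_pos:
  assumes "p \<in> quadric"
  shows "height p \<ge> 1"
proof -
  obtain a b c d e where p: "p = (a, b, c, d, e)" by (cases p)
  have "height p \<ge> 0" by (simp add: p height_def)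
  moreover have "height p \<noteq> 0"
    using assms by (auto simp: p height_def quadric_def add_nonneg_eq_0_iff)
  ultimately show ?thesis by linarith
qed

lemma height_le_norm_siegel_j:
  assumes M: "M \<in> Sp4_Z" and y: "y \<ge> 1"
  shows "real_of_int (height (pluecker M)) \<le> (norm (siegel_j M (diag_point y y)))\<^sup>2"
proof -
  obtain a b c d e where pl: "pluecker M = (a, b, c, d, e)" by (cases "pluecker M")
  have a_le: "1 * (real_of_int a)\<^sup>2 \<le> y ^ 4 * (real_of_int a)\<^sup>2"
    using y by (intro mult_right_mono one_le_power) auto
  have cde_le: "1 * ((real_of_int c)\<^sup>2 + (real_of_int d)\<^sup>2 + 2 * (real_of_int e)\<^sup>2) \<le>
      y\<^sup>2 * ((real_of_int c)\<^sup>2 + (real_of_int d)\<^sup>2 + 2 * (real_of_int e)\<^sup>2)"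
    using y by (intro mult_right_mono one_le_power) auto
  have "real_of_int (height (pluecker M)) \<le> (real_of_int b)\<^sup>2 + 1 * (real_of_int a)\<^sup>2 +
      1 * ((real_of_int c)\<^sup>2 + (real_of_int d)\<^sup>2 + 2 * (real_of_int e)\<^sup>2)"
    by (simp add: pl height_def)
  also have "\<dots> \<le> (norm (siegel_j M (diag_point y y)))\<^sup>2"
    unfolding norm_siegel_j(1)[OF M pl] by (intro add_mono order.refl a_le cde_le)
  finally show ?thesis .
qed

lemma norm_siegel_j_ge_1:
  assumes "M \<in> Sp4_Z" "y \<ge> 1"
  shows "norm (siegel_j M (diag_point y y)) \<ge> 1"
proof -
  have "1 \<le> real_of_int (height (pluecker M))"
    using height_pos[OF pluecker_in_quadric[OF assms(1)]] by simp
  also have "\<dots> \<le> (norm (siegel_j M (diag_point y y)))\<^sup>2"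
    by (rule height_le_norm_siegel_j[OF assms])
  finally show ?thesis
    using power2_le_imp_le[of 1 "norm (siegel_j M (diag_point y y))"] by simp
qed

lemma norm_siegel_j_ge_y:
  assumes M: "M \<in> Sp4_Z" "M \<notin> Sp4_Z_inf" and y: "y \<ge> 1"
  shows "y\<^sup>2 \<le> (norm (siegel_j M (diag_point y y)))\<^sup>2"
proof -
  obtain a b c d e where pl: "pluecker M = (a, b, c, d, e)" by (cases "pluecker M")
  have "a \<noteq> 0 \<or> c \<noteq> 0 \<or> d \<noteq> 0 \<or> e \<noteq> 0"
    using pluecker_cusp[OF M(1)] M(2) pl by auto
  then have "a\<^sup>2 + c\<^sup>2 + d\<^sup>2 + 2 * e\<^sup>2 \<noteq> 0"
    by (simp add: add_nonneg_eq_0_iff)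
  moreover have "a\<^sup>2 + c\<^sup>2 + d\<^sup>2 + 2 * e\<^sup>2 \<ge> 0" by simp
  ultimately have "a\<^sup>2 + c\<^sup>2 + d\<^sup>2 + 2 * e\<^sup>2 \<ge> 1" by linarith
  then have "real_of_int (a\<^sup>2 + c\<^sup>2 + d\<^sup>2 + 2 * e\<^sup>2) \<ge> 1" by linarith
  then have "y\<^sup>2 * 1 \<le> y\<^sup>2 * real_of_int (a\<^sup>2 + c\<^sup>2 + d\<^sup>2 + 2 * e\<^sup>2)"
    by (intro mult_left_mono) auto
  moreover have "y\<^sup>2 * (real_of_int a)\<^sup>2 \<le> y ^ 4 * (real_of_int a)\<^sup>2"
    using y by (intro mult_right_mono power_increasing) auto
  ultimately have "y\<^sup>2 \<le> y ^ 4 * (real_of_int a)\<^sup>2 + y\<^sup>2 * ((real_of_int c)\<^sup>2 + (real_of_int d)\<^sup>2 + 2 * (real_of_int e)\<^sup>2)"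
    by (simp add: distrib_left)
  then show ?thesis
    unfolding norm_siegel_j(1)[OF M(1) pl] using zero_le_power2[of "real_of_int b"] by linarith
qed

lemma summable_on_cosets:
  "(\<lambda>C. 1 / (real_of_int (height (pluecker (coset_rep C))))\<^sup>2) summable_on cosets"
proof -
  have inj: "inj_on (\<lambda>C. pluecker (coset_rep C)) cosets"
    by (rule inj_onI) (metis coset_eq_if_pluecker_eq coset_rep)
  have "(\<lambda>p. 1 / (real_of_int (height p))\<^sup>2) summable_on (\<lambda>C. pluecker (coset_rep C)) ` cosets"
    by (rule summable_on_subset_banach[OF summable_on_quadric])
       (use pluecker_in_quadric coset_rep(1) in blast)
  then show ?thesis
    by (simp add: summable_on_reindex[OF inj] o_def)
qed

text \<open>All terms are dominated by the convergent sum over the quadric once \<open>y \<ge> 1\<close>.  Outside of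
  \<open>Sp4_Z_inf\<close> they tend to \<open>0\<close>, and the term of \<open>Sp4_Z_inf\<close> is \<open>det(D)\<^sup>-\<^sup>k = 1\<close> for even \<open>k\<close>.\<close>

lemma siegel_E_tendsto:
  assumes k: "k \<ge> 4" "even k"
  shows "((\<lambda>y. siegel_E k (diag_point y y)) \<longlongrightarrow> 1) at_top"
proof -
  let ?j = "\<lambda>C y. siegel_j (coset_rep C) (diag_point y y)"
  let ?g = "\<lambda>C. if C = Sp4_Z_inf then 1 else 0 :: complex"
  have "((\<lambda>y. \<Sum>\<^sub>\<infinity>C\<in>cosets. inverse (?j C y ^ k)) \<longlongrightarrow> (\<Sum>\<^sub>\<infinity>C\<in>cosets. ?g C)) at_top"
  proof (rule tannery[OF _ _ summable_on_cosets])
    show "\<forall>\<^sub>F y in at_top. \<forall>C\<in>cosets. norm (inverse (?j C y ^ k)) \<le>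
        1 / (real_of_int (height (pluecker (coset_rep C))))\<^sup>2"
      using eventually_ge_at_top[of 1]
    proof (eventually_elim, intro ballI)
      fix y :: real and C assume y: "1 \<le> y" and C: "C \<in> cosets"
      note M = coset_rep(1)[OF C]
      let ?h = "real_of_int (height (pluecker (coset_rep C)))"
      have h: "?h \<ge> 1" using height_pos[OF pluecker_in_quadric[OF M]] by simp
      have "?h\<^sup>2 \<le> ((norm (?j C y))\<^sup>2)\<^sup>2"
        using h height_le_norm_siegel_j[OF M y] by (intro power_mono) auto
      also have "\<dots> = norm (?j C y) ^ 4" by (simp flip: power_mult)
      also have "\<dots> \<le> norm (?j C y) ^ k"
        using norm_siegel_j_ge_1[OF M y] k by (intro power_increasing) auto
      finally have "1 / norm (?j C y) ^ k \<le> 1 / ?h\<^sup>2"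
        using h by (intro divide_left_mono mult_pos_pos) (auto intro: order.strict_trans2[rotated])
      then show "norm (inverse (?j C y ^ k)) \<le> 1 / ?h\<^sup>2"
        by (simp add: norm_divide norm_power inverse_eq_divide)
    qed
    fix C assume C: "C \<in> cosets"
    note M = coset_rep[OF C]
    show "((\<lambda>y. inverse (?j C y ^ k)) \<longlongrightarrow> ?g C) at_top"
    proof (cases "C = Sp4_Z_inf")
      case True
      have "mat 1 ** coset_rep C \<in> coset (coset_rep C)"
        using mat_1_in_Sp4_Z_inf by blast
      then have "coset_rep C \<in> Sp4_Z_inf" using M(2) True by simp
      then obtain b where b: "pluecker (coset_rep C) = (0, b, 0, 0, 0)" "b = 1 \<or> b = -1"
        by (rule pluecker_of_cusp)
      have "?j C y ^ k = 1" for y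
        using norm_siegel_j(2)[OF M(1) b(1)] b(2) k by auto
      then show ?thesis using True by simp
    next
      case False
      have notin: "coset_rep C \<notin> Sp4_Z_inf"
        using False M(2) Sp4_Z_inf_coset by metis
      have "((\<lambda>y. inverse (?j C y ^ k)) \<longlongrightarrow> 0) at_top"
      proof (rule Lim_null_comparison)
        show "\<forall>\<^sub>F y in at_top. norm (inverse (?j C y ^ k)) \<le> inverse y"
          using eventually_ge_at_top[of 1]
        proof eventually_elim
          fix y :: real assume y: "1 \<le> y"
          have "y ^ 1 \<le> y\<^sup>2" using y by (intro power_increasing) auto
          also have "\<dots> \<le> (norm (?j C y))\<^sup>2" by (rule norm_siegel_j_ge_y[OF M(1) notin y])
          also have "\<dots> \<le> norm (?j C y) ^ k"
            using norm_siegel_j_ge_1[OF M(1) y] k by (intro power_increasing) auto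
          finally have "inverse (norm (?j C y) ^ k) \<le> inverse y"
            using y by (intro le_imp_inverse_le) auto
          then show "norm (inverse (?j C y ^ k)) \<le> inverse y"
            by (simp add: norm_inverse norm_power)
        qed
        show "((\<lambda>y :: real. inverse y) \<longlongrightarrow> 0) at_top"
          by (rule tendsto_inverse_0_at_top[OF filterlim_ident])
      qed
      then show ?thesis using False by simp
    qed
  qed auto
  also have "(\<Sum>\<^sub>\<infinity>C\<in>cosets. ?g C) = (\<Sum>\<^sub>\<infinity>C\<in>{Sp4_Z_inf}. 1)"
    using Sp4_Z_inf_in_cosets by (intro infsum_cong_neutral) auto
  finally show ?thesis
    by (simp add: siegel_E_def coset_rep_def)
qed

lemma siegel_G_constant_term:
  assumes k: "k \<ge> 4" "even k" and B: "has_fourier_expansion (siegel_G k) B"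
  shows "B 0 = of_rat (bernoulli_number k * bernoulli_number (2 * k - 2)) / of_nat (2 * k * (2 * k - 2))"
proof -
  let ?z = "1 / 2 * riemann_zeta (1 - of_nat k) * riemann_zeta (3 - 2 * of_nat k)"
  have "((\<lambda>y. siegel_G k (diag_point y y)) \<longlongrightarrow> ?z * 1) at_top"
    unfolding siegel_G_def by (intro tendsto_mult tendsto_const siegel_E_tendsto k)
  moreover have "((\<lambda>y. siegel_G k (diag_point y y)) \<longlongrightarrow> B 0) at_top"
    by (rule constant_term_eq_limit[OF B])
  ultimately have B0: "B 0 = ?z"
    using tendsto_unique[OF trivial_limit_at_top_linorder] by fastforce
  have arg: "(3 - 2 * of_nat k :: complex) = 1 - of_nat (2 * k - 2)"
    using k by (simp add: of_nat_diff)
  have "riemann_zeta (3 - 2 * of_nat k) = - of_rat (bernoulli_number (2 * k - 2)) / of_nat (2 * k - 2)"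
    unfolding arg using k by (intro riemann_zeta_at_negative) simp
  moreover have "riemann_zeta (1 - of_nat k) = - of_rat (bernoulli_number k) / of_nat k"
    using k by (intro riemann_zeta_at_negative) auto
  ultimately show ?thesis
    unfolding B0 by (simp add: of_rat_mult del: of_nat_diff)
qed

section \<open>Divisibility by a prime above $p$\<close>

lemma prime_above_closed:
  assumes "number_field K" "prime_above p K P"
  shows "a \<in> P \<Longrightarrow> of_int n * a \<in> P" and "a \<in> P \<Longrightarrow> b \<in> P \<Longrightarrow> a + b \<in> P"
    and "of_nat p \<in> P" and "b \<in> integers_of K \<Longrightarrow> a \<in> P \<Longrightarrow> b * a \<in> P"
proof -
  interpret ideal P "ring_of_integers K"
    using assms(2) by (simp add: prime_above_def primeideal_def)
  have K: "subfield K complex_ring"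
    using assms(1) by (simp add: number_field_def)
  have "subring K complex_ring"
    using K by (simp add: subfield_def subdomain_def subcring_def)
  note sub = subringE[OF this]
  have nat: "of_nat n \<in> K" for n :: nat
  proof (induction n)
    case 0 show ?case using sub(2) by (simp add: ring_of_type_algebra_def)
  next
    case (Suc n)
    then show ?case using sub(7)[OF sub(3) Suc] by (simp add: ring_of_type_algebra_def)
  qed
  have minus: "- x \<in> K" if "x \<in> K" for x
  proof -
    have "x + \<ominus>\<^bsub>complex_ring\<^esub> x = 0"
      using cring.cring_simprules(17)[OF cring_from_type_algebra, of x]
      by (simp add: ring_of_type_algebra_def)
    then have "\<ominus>\<^bsub>complex_ring\<^esub> x = - x"
      by (simp only: add_eq_0_iff)
    then show ?thesis
      using sub(5)[OF that] by simp
  qed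
  have int: "of_int n \<in> integers_of K" for n :: int
    using nat minus by (cases n rule: int_cases2) (auto simp: integers_of_def)
  show "a + b \<in> P" if "a \<in> P" "b \<in> P"
    using additive_subgroup.a_closed[OF is_additive_subgroup that] by (simp add: ring_of_type_algebra_def)
  show "of_int n * a \<in> P" if "a \<in> P"
    using I_l_closed[OF that] int[of n] by (simp add: ring_of_type_algebra_def)
  show "b * a \<in> P" if "b \<in> integers_of K" "a \<in> P" for b a
    using I_l_closed[OF that(2)] that(1) by (simp add: ring_of_type_algebra_def)
  show "of_nat p \<in> P"
    using assms(2) by (simp add: prime_above_def)
qed

text \<open>If \<open>u\<close> is prime to \<open>p\<close>, a Bezout relation between \<open>u\<close> and \<open>p\<close> puts the denominator of an
  element \<open>u / v = a / s\<close> of the maximal ideal into \<open>P\<close>.\<close>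

lemma local_max_ideal_numerator:
  assumes K: "number_field K" "prime_above p K P" and p: "Factorial_Ring.prime p"
    and uv: "of_int u / of_int v \<in> local_max_ideal K P" and v: "v \<noteq> 0"
  shows "int p dvd u"
proof (rule ccontr)
  assume "\<not> int p dvd u"
  then have "coprime u (int p)"
    using p prime_imp_coprime[of "int p" u] by (simp add: coprime_commute)
  then obtain \<alpha> \<beta> where bez: "\<alpha> * u + \<beta> * int p = 1"
    using bezout_int[of u "int p"] by auto
  from uv obtain a s where as: "a \<in> P" "s \<in> integers_of K" "s \<notin> P" and eq: "of_int u / of_int v = a / s"
    unfolding local_max_ideal_def by blast
  note P = prime_above_closed[OF K]
  have sp: "s * of_nat p \<in> P"
    using P(4)[OF as(2) P(3)] .
  have "0 \<in> P" using P(1)[OF as(1), of 0] by simp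
  with as have "s \<noteq> 0" by auto
  then have us: "of_int u * s = of_int v * a"
    using eq v by (simp add: field_simps)
  have "s = of_int (\<alpha> * u + \<beta> * int p) * s"
    unfolding bez by simp
  also have "\<dots> = of_int \<alpha> * (of_int u * s) + of_int \<beta> * (s * of_nat p)"
    by (simp add: algebra_simps)
  also have "of_int u * s = of_int v * a"
    by (rule us)
  finally have s: "s = of_int \<alpha> * (of_int v * a) + of_int \<beta> * (s * of_nat p)" .
  have "s \<in> P"
    by (subst s) (intro P as sp)
  then show False using as by simp
qed

text \<open>Multiplication by an integer can cancel factors \<open>p\<close> of the denominator but not of the numerator.\<close>

lemma ord_p_zero_numerator:
  assumes p: "Factorial_Ring.prime p" and ord: "ord_p p (x * of_nat h) = 0"
  shows "\<not> int p dvd fst (quotient_of x)"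
proof
  assume dvd: "int p dvd fst (quotient_of x)"
  obtain u v where uv: "quotient_of x = (u, v)" by (cases "quotient_of x")
  obtain u' v' where uv': "quotient_of (x * of_nat h) = (u', v')" by (cases "quotient_of (x * of_nat h)")
  have v: "v > 0" "v' > 0" using uv uv' by (auto intro: quotient_of_denom_pos)
  have cop: "coprime u v" "coprime u' v'" using uv uv' by (auto intro: quotient_of_coprime)
  have x: "x = of_int u / of_int v" "x * of_nat h = of_int u' / of_int v'"
    using uv uv' by (auto intro: quotient_of_div)
  have prime: "Factorial_Ring.prime (int p)" using p by simp
  have nz: "x * of_nat h \<noteq> 0"
  proof
    assume "x * of_nat h = 0"
    then have "ord_p p (x * of_nat h) = \<infinity>" unfolding ord_p_def by (rule if_P)
    with ord show False by simp
  qed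
  with ord uv' have mult: "multiplicity (int p) u' = multiplicity (int p) v'"
    by (simp add: ord_p_def split: if_splits)
  have "u' \<noteq> 0" using nz x(2) by auto
  have "\<not> int p dvd u'"
  proof
    assume pu: "int p dvd u'"
    then have "multiplicity (int p) u' \<noteq> 0"
      using \<open>u' \<noteq> 0\<close> prime multiplicity_eq_zero_iff[of u' "int p"] not_prime_unit by blast
    then have "int p dvd v'"
      using mult not_dvd_imp_multiplicity_0 by metis
    with pu cop(2) have "is_unit (int p)" by (meson coprime_common_divisor)
    with prime show False by (simp add: not_prime_unit)
  qed
  moreover have "\<not> int p dvd v"
  proof
    assume "int p dvd v"
    with dvd uv cop(1) have "is_unit (int p)" by (metis coprime_common_divisor fst_conv)
    with prime show False by (simp add: not_prime_unit)
  qed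
  moreover have "int p dvd u' * v"
  proof -
    have u: "of_int u = x * of_int v" and u': "of_int u' = x * of_nat h * of_int v'"
      using x v by (simp_all add: field_simps)
    have "(of_int (u * int h * v') :: rat) = (x * of_int v) * of_nat h * of_int v'"
      by (simp add: u)
    also have "\<dots> = of_int (u' * v)"
      by (simp add: u' mult_ac)
    finally have "(of_int (u * int h * v') :: rat) = of_int (u' * v)" .
    then have "u * int h * v' = u' * v" by (simp only: of_int_eq_iff)
    with dvd uv show ?thesis by (metis dvd_mult2 fst_conv)
  qed
  ultimately show False
    using prime by (simp add: prime_dvd_mult_iff)
qed

section \<open>Absence of congruent cusp forms\<close>

lemma no_congruence:
  assumes k: "k \<ge> 4" "even k" and p: "Factorial_Ring.prime p"
    and ord: "ord_p p (bernoulli_number k * bernoulli_number (2 * k - 2) * of_nat h) = 0"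
    and F: "siegel_cusp_form k F" and K: "number_field K" "prime_above p K P"
    and cong: "siegel_congruent K P F (siegel_G k)"
  shows False
proof -
  obtain A B where A: "has_fourier_expansion F A" and B: "has_fourier_expansion (siegel_G k) B"
    and AB: "\<forall>T\<in>half_integral_psd. A T - B T \<in> local_max_ideal K P"
    using cong unfolding siegel_congruent_def by blast
  define x where "x = bernoulli_number k * bernoulli_number (2 * k - 2)"
  obtain u v where uv: "quotient_of x = (u, v)" by (cases "quotient_of x")
  have v: "v > 0" using uv by (auto intro: quotient_of_denom_pos)
  let ?n = "int (2 * k * (2 * k - 2))"
  have "A 0 - B 0 = - (of_rat x / of_nat (2 * k * (2 * k - 2)))"
    using cusp_form_constant_term[OF F A] siegel_G_constant_term[OF k B] by (simp add: x_def)
  also have "of_rat x = (of_int u / of_int v :: complex)"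
    using quotient_of_div[OF uv] by (simp add: of_rat_divide)
  also have "- (of_int u / of_int v / of_nat (2 * k * (2 * k - 2))) = (of_int (- u) / of_int (v * ?n) :: complex)"
    by (simp del: of_nat_diff)
  finally have "(of_int (- u) / of_int (v * ?n) :: complex) \<in> local_max_ideal K P"
    using AB zero_in_half_integral_psd by metis
  moreover have "v * ?n \<noteq> 0" using v k by simp
  ultimately have "int p dvd - u"
    by (rule local_max_ideal_numerator[OF K p])
  then show False
    using ord_p_zero_numerator[OF p ord[folded x_def]] uv by simp
qed

theorem corollary1p5:
  fixes k p :: nat
  assumes "k \<ge> 4" and "even k" and "Factorial_Ring.prime p" and "p \<ge> 7" and "p - 1 > 2 * k - 2"
  shows "(ord_p p (bernoulli_number k * bernoulli_number (2 * k - 2) * of_nat (h_plus p)) = 0 \<longrightarrow>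
            \<not> (\<exists>F K P. siegel_cusp_form k F \<and> hecke_eigenform k F \<and> number_field K \<and>
                  prime_above p K P \<and> siegel_congruent K P F (siegel_G k)))
       \<and> (vandiver_conjecture \<longrightarrow>
            ord_p p (bernoulli_number k * bernoulli_number (2 * k - 2)) = 0 \<longrightarrow>
            \<not> (\<exists>F K P. siegel_cusp_form k F \<and> hecke_eigenform k F \<and> number_field K \<and>
                  prime_above p K P \<and> siegel_congruent K P F (siegel_G k)))"
  using no_congruence[OF assms(1-3), of "h_plus p"]
    no_congruence[OF assms(1-3), of 1, unfolded of_nat_1 mult_1_right]
  by blast

end
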